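(* Consider the momentum stochastic gradient descent (MSGD) process $(X_n,V_n)_{n\in\mathbb N_0}$ of the context with constant step-sizes $\gamma_n\equiv\gamma>0$ and friction parameter $\mu>0$. Let $L>0$ and $\sigma\ge 0$, let $\mathcal D\subset\mathbb R^d$ be open, and assume $|\nabla f(x)|^2\ge 2Lf(x)$ for all $x\in\mathcal D$. For $n\in\mathbb N_0$ let $\mathbb A_n=\{X_i\in\mathcal D\text{ for all }i=0,\dots,n\}$ and assume that for all $n\in\mathbb N_0$ $$\mathbb E[|D_{n+1}|^2\mid\mathcal F_n]\le\sigma f(X_n)\quad\text{on }\mathbb A_n.$$ Suppose there exist $a,b\ge 0$ such that all of the following inequalities hold: \begin{align*} 0\ge{}&-1+\gamma\Bigl(\tfrac b2-a\Bigr)+\gamma^2C_L+\gamma^3\tfrac{C_La}{2},\\ 0\ge{}&a\mu+ab-a^2-2L+\gamma\Bigl(\tfrac{b\sigma}{2}+a(2C_L-\mu b+\mu a)-2L\bigl(a-\tfrac b2\bigr)\Bigr)\\ &+\gamma^2C_L\bigl(\sigma+a^2-2a\mu+2L\bigr)+\gamma^3C_La\Bigl(\tfrac\sigma2-a\mu+L\Bigr),\\ 0\ge{}&C_L-\tfrac b2(\mu+a-b)+\gamma\Bigl(\tfrac{b\mu^2}{2}+\tfrac{C_La}{2}-2C_L\mu+\tfrac{ba\mu}{2}-\tfrac{b^2\mu}{2}+C_Lb\Bigr)\\ &+\gamma^2C_L\Bigl(\mu^2-a\mu+\tfrac{ba}{2}-b\mu\Bigr)+\gamma^3\tfrac{C_La\mu}{2}(\mu-b),\\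 0\le{}&\delta:=1+\gamma(a-\mu-b)+\gamma^2(b\mu-a\mu-2C_L)+\gamma^3(2C_L\mu-C_La)+\gamma^4C_La\mu,\\ &ab\ge C_L,\qquad \gamma\le\tfrac{b}{C_L}. \end{align*} Then: (i) With $r_{\mathrm{MSGD}}:=\min(1+a\gamma,\delta^{-1})$, for all $\varepsilon\in(0,r_{\mathrm{MSGD}})$ one has $\mathbb E[\mathbf 1_{\mathbb A_{n-1}}f(X_n)]=o\bigl((r_{\mathrm{MSGD}}-\varepsilon)^{-n}\bigr)$ as $n\to\infty$. (ii) If $\delta<1$, the process $(X_n)_{n\in\mathbb N_0}$ converges almost surely on $\mathbb A_\infty:=\bigcap_{n\in\mathbb N_0}\mathbb A_n$. Moreover, for fixed $\mu>0$ (and fixed $L>0$, $\sigma\ge0$, $C_L\ge0$) there exists $\gamma_0>0$ such that for every $\gamma\in(0,\gamma_0]$ there exist constants $a,b$ for which all the inequalities above hold and $\delta<1$.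
   Context: Setting. $f:\mathbb R^d\to\mathbb R$ is differentiable with $C_L$-Lipschitz continuous gradient for some constant $C_L\ge 0$, and $\inf_{x\in\mathbb R^d}f(x)=0$. On a filtered probability space $(\Omega,(\mathcal F_n)_{n\in\mathbb N_0},\mathcal F,\mathbb P)$, $(X_n)_{n\in\mathbb N_0}$ and $(V_n)_{n\in\mathbb N_0}$ are $(\mathcal F_n)$-adapted $\mathbb R^d$-valued processes satisfying, for all $n\in\mathbb N_0$, $$X_{n+1}=X_n+\gamma_{n+1}V_{n+1},\qquad V_{n+1}=V_n-\gamma_{n+1}\mu V_n-\gamma_{n+1}\nabla f(X_n)+\gamma_{n+1}D_{n+1},$$ where $X_0,V_0\in L^2(\Omega,\mathcal F_0)$, $(\gamma_n)_{n\in\mathbb N}$ are strictly positive reals, $\mu>0$, and $(D_n)_{n\in\mathbb N}$ is a sequence of $L^2$-martingale differences with respect to $(\mathcal F_n)$ (i.e. $D_n$ is $\mathcal F_n$-measurable, square integrable and $\mathbb E[D_{n+1}\mid\mathcal F_n]=0$). Conventions: $\delta^{-1}=+\infty$ if $\delta=0$; the condition $\gamma\le b/C_L$ is read as $\gamma C_L\le b$. *)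

theory Defs
  imports "HOL-Probability.Probability"
begin

locale filtered_prob_space = prob_space M + filtration "space M" F
  for M :: "'w measure" and F :: "nat \<Rightarrow> 'w measure" +
  assumes subalgebra_F: "subalgebra M (F n)"

definition square_integrable :: "'w measure \<Rightarrow> ('w \<Rightarrow> 'a::euclidean_space) \<Rightarrow> bool" where
  "square_integrable M Z \<longleftrightarrow>
     Z \<in> borel_measurable M \<and> integrable M (\<lambda>\<omega>. (norm (Z \<omega>))\<^sup>2)"

text \<open>
  The library only has conditional expectations of real random variables, so a vector-valued
  conditional expectation is taken coordinatewise. Indices start at 1: the value of \<open>D\<close> at 0
  is irrelevant.
\<close>
definition L2_martingale_differences ::
  "'w measure \<Rightarrow> (nat \<Rightarrow> 'w measure) \<Rightarrow> (nat \<Rightarrow> 'w \<Rightarrow> 'a::euclidean_space) \<Rightarrow> bool" where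
  "L2_martingale_differences M F D \<longleftrightarrow>
     (\<forall>n. D (Suc n) \<in> borel_measurable (F (Suc n)) \<and>
          square_integrable M (D (Suc n)) \<and>
          (\<forall>i\<in>Basis. AE \<omega> in M. real_cond_exp M (F n) (\<lambda>\<omega>. D (Suc n) \<omega> \<bullet> i) \<omega> = 0))"

text \<open>
  \<open>df\<close> is the gradient of \<open>f\<close>; note that \<open>lipschitz_on\<close> includes that the constant is
  nonnegative. The clause \<open>bdd_below\<close> is needed because \<open>Inf\<close> on the reals is unspecified for
  sets that are not bounded below. The step sizes are indexed from 1.
\<close>
locale msgd = filtered_prob_space M F
  for M :: "'w measure" and F :: "nat \<Rightarrow> 'w measure" +
  fixes f :: "'a::euclidean_space \<Rightarrow> real" and df :: "'a \<Rightarrow> 'a"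
    and C\<^sub>L \<mu> :: real and \<gamma> :: "nat \<Rightarrow> real"
    and X V D :: "nat \<Rightarrow> 'w \<Rightarrow> 'a"
  assumes gradient: "GDERIV f x :> df x"
    and gradient_lipschitz: "C\<^sub>L-lipschitz_on UNIV df"
    and f_bdd_below: "bdd_below (range f)"
    and f_inf: "(INF x. f x) = 0"
    and friction_pos: "\<mu> > 0"
    and step_pos: "\<gamma> (Suc n) > 0"
    and X_adapted: "X n \<in> borel_measurable (F n)"
    and V_adapted: "V n \<in> borel_measurable (F n)"
    and X0_L2: "square_integrable M (X 0)"
    and V0_L2: "square_integrable M (V 0)"
    and D_mart_diff: "L2_martingale_differences M F D"
    and X_step: "\<omega> \<in> space M \<Longrightarrow> X (Suc n) \<omega> = X n \<omega> + \<gamma> (Suc n) *\<^sub>R V (Suc n) \<omega>"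
    and V_step: "\<omega> \<in> space M \<Longrightarrow>
      V (Suc n) \<omega> = V n \<omega> - (\<gamma> (Suc n) * \<mu>) *\<^sub>R V n \<omega> - \<gamma> (Suc n) *\<^sub>R df (X n \<omega>)
                    + \<gamma> (Suc n) *\<^sub>R D (Suc n) \<omega>"

definition stay_event :: "'w measure \<Rightarrow> (nat \<Rightarrow> 'w \<Rightarrow> 'a) \<Rightarrow> 'a set \<Rightarrow> nat \<Rightarrow> 'w set" where
  "stay_event M X U n = {\<omega> \<in> space M. \<forall>i\<le>n. X i \<omega> \<in> U}"

definition msgd_delta :: "real \<Rightarrow> real \<Rightarrow> real \<Rightarrow> real \<Rightarrow> real \<Rightarrow> real" where
  "msgd_delta C\<^sub>L \<mu> \<gamma> a b =
     1 + \<gamma> * (a - \<mu> - b) + \<gamma>^2 * (b * \<mu> - a * \<mu> - 2 * C\<^sub>L)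
       + \<gamma>^3 * (2 * C\<^sub>L * \<mu> - C\<^sub>L * a) + \<gamma>^4 * C\<^sub>L * a * \<mu>"

text \<open>The last inequality is \<open>\<gamma> \<le> b / C\<^sub>L\<close>, where the right-hand side is infinite for \<open>C\<^sub>L = 0\<close>.\<close>
definition msgd_conditions ::
  "real \<Rightarrow> real \<Rightarrow> real \<Rightarrow> real \<Rightarrow> real \<Rightarrow> real \<Rightarrow> real \<Rightarrow> bool" where
  "msgd_conditions C\<^sub>L L \<sigma> \<mu> \<gamma> a b \<longleftrightarrow>
     a \<ge> 0 \<and> b \<ge> 0 \<and>
     0 \<ge> - 1 + \<gamma> * (b / 2 - a) + \<gamma>^2 * C\<^sub>L + \<gamma>^3 * (C\<^sub>L * a / 2) \<and>
     0 \<ge> a * \<mu> + a * b - a^2 - 2 * L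
          + \<gamma> * (b * \<sigma> / 2 + a * (2 * C\<^sub>L - \<mu> * b + \<mu> * a) - 2 * L * (a - b / 2))
          + \<gamma>^2 * C\<^sub>L * (\<sigma> + a^2 - 2 * a * \<mu> + 2 * L)
          + \<gamma>^3 * C\<^sub>L * a * (\<sigma> / 2 - a * \<mu> + L) \<and>
     0 \<ge> C\<^sub>L - b / 2 * (\<mu> + a - b)
          + \<gamma> * (b * \<mu>^2 / 2 + C\<^sub>L * a / 2 - 2 * C\<^sub>L * \<mu> + b * a * \<mu> / 2 - b^2 * \<mu> / 2 + C\<^sub>L * b)
          + \<gamma>^2 * C\<^sub>L * (\<mu>^2 - a * \<mu> + b * a / 2 - b * \<mu>)
          + \<gamma>^3 * (C\<^sub>L * a * \<mu> / 2) * (\<mu> - b) \<and>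
     0 \<le> msgd_delta C\<^sub>L \<mu> \<gamma> a b \<and>
     a * b \<ge> C\<^sub>L \<and>
     \<gamma> * C\<^sub>L \<le> b"

text \<open>The minimum of \<open>1 + a \<gamma>\<close> and \<open>1 / \<delta>\<close>, where \<open>1 / \<delta>\<close> is infinite for \<open>\<delta> = 0\<close>.\<close>
definition r_MSGD :: "real \<Rightarrow> real \<Rightarrow> real \<Rightarrow> real \<Rightarrow> real \<Rightarrow> real" where
  "r_MSGD C\<^sub>L \<mu> \<gamma> a b =
     (let \<delta> = msgd_delta C\<^sub>L \<mu> \<gamma> a b
      in if \<delta> = 0 then 1 + a * \<gamma> else min (1 + a * \<gamma>) (1 / \<delta>))"

end

theory Submission
  imports Defs
begin

text \<open>
  The proof rests on the Lyapunov function \<open>E(x, v) = a f(x) + \<langle>\<nabla>f(x), v\<rangle> + (b/2) |v|\<^sup>2\<close>, which is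
  nonnegative because \<open>|\<nabla>f|\<^sup>2 \<le> 2 C\<^sub>L f\<close> and \<open>a b \<ge> C\<^sub>L\<close>. Expanding one step of the process,
  the first three parameter inequalities are the signs of the coefficients of \<open>|\<nabla>f|\<^sup>2\<close>, \<open>f\<close> and
  \<open>|v|\<^sup>2\<close> that remain after \<open>\<delta> E\<close> has been split off, so that the mean of \<open>E\<close> on the stay events
  contracts by the factor \<open>\<delta>\<close>. Since \<open>\<gamma> C\<^sub>L \<le> b\<close>, one also has
  \<open>(1 + a \<gamma>) f(X\<^bsub>n+1\<^esub>) \<le> f(X\<^sub>n) + \<gamma> E(X\<^bsub>n+1\<^esub>, V\<^bsub>n+1\<^esub>)\<close>, which transfers the decay to \<open>f\<close> up to a
  linear factor. If \<open>\<delta> < 1\<close>, the mean of \<open>|V\<^sub>n|\<^sup>2\<close> decays geometrically as well, and the increments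
  of \<open>X\<close> are almost surely summable. For small \<open>\<gamma>\<close> the inequalities hold by continuity once
  they are strict at \<open>\<gamma> = 0\<close>.
\<close>

section \<open>Functions with Lipschitz continuous gradient\<close>

text \<open>The descent lemma. Along the segment from \<open>x\<close> to \<open>x + h\<close>, the
  function \<open>g\<close> removes the linear and quadratic terms from \<open>f\<close>;
  Cauchy-Schwarz and the Lipschitz bound make its derivative nonpositive, so
  \<open>g 1 \<le> g 0\<close>.\<close>

lemma lipschitz_gradient_upper_bound:
  fixes f :: "'a::euclidean_space \<Rightarrow> real"
  assumes grad: "\<And>x. GDERIV f x :> df x" and lip: "C-lipschitz_on UNIV df"
  shows "f (x + h) \<le> f x + df x \<bullet> h + C / 2 * (norm h)\<^sup>2"
proof -
  define g where "g t = f (x + t *\<^sub>R h) - t * (df x \<bullet> h) - C / 2 * (norm h)\<^sup>2 * t\<^sup>2" for t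
  have deriv: "(g has_real_derivative (df (x + t *\<^sub>R h) - df x) \<bullet> h - C * t * (norm h)\<^sup>2) (at t)" for t
  proof -
    have "((\<lambda>t. x + t *\<^sub>R h) has_derivative (\<lambda>s. s *\<^sub>R h)) (at t)"
      by (auto intro!: derivative_eq_intros)
    from has_derivative_compose[OF this grad[unfolded gderiv_def]]
    have "((\<lambda>t. f (x + t *\<^sub>R h)) has_real_derivative h \<bullet> df (x + t *\<^sub>R h)) (at t)"
      by (rule has_derivative_imp_has_field_derivative) simp
    then show ?thesis
      unfolding g_def
      by (auto intro!: derivative_eq_intros simp: inner_diff_left inner_diff_right inner_commute)
  qed
  have "g 1 \<le> g 0"
  proof (rule DERIV_nonpos_imp_nonincreasing[where a = 0 and b = 1 and f = g])
    fix t :: real assume t: "0 \<le> t" "t \<le> 1"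
    have "(df (x + t *\<^sub>R h) - df x) \<bullet> h \<le> norm (df (x + t *\<^sub>R h) - df x) * norm h"
      by (rule norm_cauchy_schwarz)
    also have "\<dots> \<le> (C * norm (t *\<^sub>R h)) * norm h"
      using lipschitz_onD[OF lip, of "x + t *\<^sub>R h" x]
      by (intro mult_right_mono) (auto simp: dist_norm)
    also have "\<dots> = C * t * (norm h)\<^sup>2"
      using t by (simp add: power2_eq_square)
    finally show "\<exists>y. (g has_real_derivative y) (at t) \<and> y \<le> 0"
      using deriv[of t] by (intro exI conjI) auto
  qed simp
  then show ?thesis by (simp add: g_def)
qed

lemma lipschitz_gradient_lower_bound:
  fixes f :: "'a::euclidean_space \<Rightarrow> real"
  assumes grad: "\<And>x. GDERIV f x :> df x" and lip: "C-lipschitz_on UNIV df"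
  shows "f (x + h) \<ge> f x + df x \<bullet> h - C / 2 * (norm h)\<^sup>2"
proof -
  have "GDERIV (\<lambda>x. - f x) x :> - df x" for x
    by (rule GDERIV_minus[OF grad])
  moreover have "C-lipschitz_on UNIV (\<lambda>x. - df x)"
    using lip by (simp add: lipschitz_on_def dist_norm norm_minus_commute)
  ultimately show ?thesis
    using lipschitz_gradient_upper_bound[of "\<lambda>x. - f x" "\<lambda>x. - df x" C x h] by simp
qed

text \<open>A step of length \<open>t\<close> against the gradient cannot push \<open>f\<close>
  below 0, so the guaranteed decrease is at most \<open>f x\<close>. The best choice is
  \<open>t = 1 / C\<close>; for \<open>C = 0\<close> arbitrarily long steps are allowed and the
  gradient must vanish.\<close>

lemma gradient_norm_le_of_nonneg:
  fixes f :: "'a::euclidean_space \<Rightarrow> real"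
  assumes grad: "\<And>x. GDERIV f x :> df x" and lip: "C-lipschitz_on UNIV df"
    and nonneg: "\<And>x. f x \<ge> 0"
  shows "(norm (df x))\<^sup>2 \<le> 2 * C * f x"
proof -
  have C: "C \<ge> 0" using lip by (rule lipschitz_on_nonneg)
  have descent: "t * (norm (df x))\<^sup>2 - C / 2 * t\<^sup>2 * (norm (df x))\<^sup>2 \<le> f x" for t
    using lipschitz_gradient_upper_bound[OF grad lip, of x "- t *\<^sub>R df x"] nonneg[of "x - t *\<^sub>R df x"]
    by (simp add: power_mult_distrib dot_square_norm)
  show ?thesis
  proof (cases "C = 0")
    case True
    have "df x = 0"
    proof (rule ccontr)
      assume "df x \<noteq> 0"
      then show False
        \<comment> \<open>With this step length the descent bound reads
          \<open>f x + 1 \<le> f x\<close>.\<close>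
        using descent[of "(f x + 1) / (norm (df x))\<^sup>2"] True by simp
    qed
    then show ?thesis using True by simp
  next
    case False
    then show ?thesis
      using descent[of "1 / C"] C by (simp add: field_simps power2_eq_square)
  qed
qed

section \<open>The parameter inequalities\<close>

text \<open>The algebraic core, to be read with \<open>F = f(X n)\<close>, \<open>g\<close> the
  squared gradient norm, \<open>p\<close> the inner product of gradient and velocity, and
  \<open>w\<close> the squared velocity norm. The cross term cancels because \<open>\<delta>\<close>
  is exactly the coefficient of \<open>p\<close> on the left, namely \<open>(1 - \<gamma> * \<mu>) *
  (1 + a * \<gamma> - 2 * \<gamma> * K)\<close>.\<close>

lemma lyapunov_coefficient_bound:
  fixes a b C L \<sigma> \<mu> \<gamma> w g p F :: real
  assumes cond: "msgd_conditions C L \<sigma> \<mu> \<gamma> a b" and "\<gamma> > 0"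
    and "F \<ge> 0" "w \<ge> 0" and g: "g \<ge> 2 * L * F"
  defines "K \<equiv> b / 2 + C * \<gamma> + a * C * \<gamma>\<^sup>2 / 2"
  shows "a * F + (1 + a * \<gamma>) * ((1 - \<gamma> * \<mu>) * p - \<gamma> * g)
           + K * ((1 - \<gamma> * \<mu>)\<^sup>2 * w - 2 * \<gamma> * (1 - \<gamma> * \<mu>) * p + \<gamma>\<^sup>2 * g) + K * \<gamma>\<^sup>2 * (\<sigma> * F)
         \<le> msgd_delta C \<mu> \<gamma> a b * (a * F + p + b / 2 * w)"
proof -
  define c1 where "c1 = - 1 + \<gamma> * (b / 2 - a) + \<gamma>^2 * C + \<gamma>^3 * (C * a / 2)"
  define c2 where "c2 = a * \<mu> + a * b - a^2 - 2 * L
          + \<gamma> * (b * \<sigma> / 2 + a * (2 * C - \<mu> * b + \<mu> * a) - 2 * L * (a - b / 2))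
          + \<gamma>^2 * C * (\<sigma> + a^2 - 2 * a * \<mu> + 2 * L)
          + \<gamma>^3 * C * a * (\<sigma> / 2 - a * \<mu> + L)"
  define c3 where "c3 = C - b / 2 * (\<mu> + a - b)
          + \<gamma> * (b * \<mu>^2 / 2 + C * a / 2 - 2 * C * \<mu> + b * a * \<mu> / 2 - b^2 * \<mu> / 2 + C * b)
          + \<gamma>^2 * C * (\<mu>^2 - a * \<mu> + b * a / 2 - b * \<mu>)
          + \<gamma>^3 * (C * a * \<mu> / 2) * (\<mu> - b)"
  have c: "c1 \<le> 0" "c2 \<le> 0" "c3 \<le> 0"
    using cond by (auto simp: msgd_conditions_def c1_def c2_def c3_def)
  \<comment> \<open>Since \<open>c1\<close> is nonpositive, \<open>g\<close> may be traded for its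
    lower bound \<open>2 * L * F\<close>; the resulting term \<open>2 * L * c1\<close> is already
    contained in \<open>c2\<close>.\<close>
  have "c1 * (g - 2 * L * F) \<le> 0" "c2 * F \<le> 0" "c3 * w \<le> 0"
    using c assms by (auto intro!: mult_nonpos_nonneg)
  then have "\<gamma> * (c1 * (g - 2 * L * F) + c2 * F + c3 * w) \<le> 0"
    using \<open>\<gamma> > 0\<close> by (intro mult_nonneg_nonpos) auto
  moreover have "a * F + (1 + a * \<gamma>) * ((1 - \<gamma> * \<mu>) * p - \<gamma> * g)
           + K * ((1 - \<gamma> * \<mu>)\<^sup>2 * w - 2 * \<gamma> * (1 - \<gamma> * \<mu>) * p + \<gamma>\<^sup>2 * g) + K * \<gamma>\<^sup>2 * (\<sigma> * F)
         = msgd_delta C \<mu> \<gamma> a b * (a * F + p + b / 2 * w)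
           + \<gamma> * (c1 * (g - 2 * L * F) + c2 * F + c3 * w)"
    unfolding K_def c1_def c2_def c3_def msgd_delta_def
    by (simp add: algebra_simps add_divide_distrib diff_divide_distrib power_numeral_reduce)
  ultimately show ?thesis by linarith
qed

lemma friction_factor_le_delta:
  assumes cond: "msgd_conditions C L \<sigma> \<mu> \<gamma> a b" and "\<gamma> > 0" "C \<ge> 0" "b > 0"
  shows "(1 - \<gamma> * \<mu>)\<^sup>2 \<le> msgd_delta C \<mu> \<gamma> a b"
proof -
  let ?K = "b / 2 + C * \<gamma> + a * C * \<gamma>\<^sup>2 / 2"
  have a: "a \<ge> 0" using cond by (simp add: msgd_conditions_def)
  have "b / 2 * (1 - \<gamma> * \<mu>)\<^sup>2 \<le> ?K * (1 - \<gamma> * \<mu>)\<^sup>2"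
    using assms a by (intro mult_right_mono) auto
  also have "\<dots> \<le> b / 2 * msgd_delta C \<mu> \<gamma> a b"
    \<comment> \<open>Setting \<open>w = 1\<close> and the other quantities to 0 isolates the third
      parameter inequality.\<close>
    using lyapunov_coefficient_bound[OF cond \<open>\<gamma> > 0\<close>, of 0 1 0 0] by (simp add: mult.commute)
  finally show ?thesis using \<open>b > 0\<close> by simp
qed

lemma friction_factor_less_1:
  assumes cond: "msgd_conditions C L \<sigma> \<mu> \<gamma> a b" and "\<gamma> > 0" "\<mu> > 0" "C \<ge> 0"
    and delta: "msgd_delta C \<mu> \<gamma> a b < 1"
  shows "(1 - \<gamma> * \<mu>)\<^sup>2 < 1"
proof (cases "b = 0")
  case True
  have a: "a \<ge> 0" and d: "msgd_delta C \<mu> \<gamma> a b \<ge> 0" and "\<gamma> * C \<le> 0"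
    using cond True by (auto simp: msgd_conditions_def)
  then have "C = 0" using \<open>\<gamma> > 0\<close> \<open>C \<ge> 0\<close> by (auto simp: mult_le_0_iff)
  \<comment> \<open>For \<open>b = 0\<close> and \<open>C = 0\<close> the polynomial factors, so
    \<open>\<delta> \<ge> 0\<close> rules out a negative
    \<open>1 - \<gamma> * \<mu>\<close>.\<close>
  then have "msgd_delta C \<mu> \<gamma> a b = (1 - \<gamma> * \<mu>) * (1 + a * \<gamma>)"
    using True unfolding msgd_delta_def by algebra
  moreover have "1 + a * \<gamma> > 0" using a \<open>\<gamma> > 0\<close> by (simp add: add_pos_nonneg)
  ultimately have "1 - \<gamma> * \<mu> \<ge> 0" using d by (simp add: zero_le_mult_iff)
  moreover have "1 - \<gamma> * \<mu> < 1" using \<open>\<gamma> > 0\<close> \<open>\<mu> > 0\<close> by simp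
  ultimately show ?thesis by (simp add: abs_square_less_1)
next
  case False
  then have "b > 0" using cond by (auto simp: msgd_conditions_def)
  then show ?thesis using friction_factor_le_delta[of C L \<sigma> \<mu> \<gamma> a b] assms by auto
qed

text \<open>One pair \<open>a\<close>, \<open>b\<close> serves all small \<open>\<gamma>\<close>: it
  suffices that the leading terms at \<open>\<gamma> = 0\<close> have the strict sign, since
  everything is polynomial in \<open>\<gamma>\<close>.\<close>

lemma msgd_conditions_small_step:
  fixes C L \<sigma> \<mu> :: real
  assumes "C \<ge> 0" "L > 0" "\<mu> > 0"
  obtains a b where
    "\<forall>\<^sub>F \<gamma> in at_right 0. msgd_conditions C L \<sigma> \<mu> \<gamma> a b \<and> msgd_delta C \<mu> \<gamma> a b < 1"
proof -
  \<comment> \<open>With \<open>a = \<mu> + b - \<eta>\<close>, the constant terms of the second and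
    third inequalities are \<open>a * \<eta> - 2 * L\<close> and
    \<open>C - b / 2 * (2 * \<mu> - \<eta>)\<close>, and \<open>\<delta>\<close> has slope
    \<open>- \<eta>\<close> at 0. All are negative once \<open>b * \<mu> > 2 * C\<close> and
    \<open>\<eta>\<close> is positive but small; the summand 1 keeps \<open>b\<close> positive when
    \<open>C = 0\<close>.\<close>
  define b where "b = 2 * C / \<mu> + 1"
  define \<eta> where "\<eta> = min (\<mu> / 2) (L / (\<mu> + b))"
  define a where "a = \<mu> + b - \<eta>"
  have b: "b > 0" "b * \<mu> > 2 * C" using assms by (auto simp: b_def field_simps intro: add_nonneg_pos)
  have \<eta>: "\<eta> > 0" "\<eta> \<le> \<mu> / 2" using b assms unfolding \<eta>_def by (simp, linarith)
  have "(\<mu> + b) * \<eta> \<le> (\<mu> + b) * (L / (\<mu> + b))"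
    using b assms by (intro mult_left_mono) (auto simp: \<eta>_def)
  also have "\<dots> = L" using b assms by (simp add: field_simps)
  finally have \<eta>L: "(\<mu> + b) * \<eta> \<le> L" .
  have a: "a > \<mu> / 2" using b \<eta> by (simp add: a_def)
  have "a * \<eta> \<le> (\<mu> + b) * \<eta>" using \<eta> by (intro mult_right_mono) (auto simp: a_def)
  then have "a * \<eta> < 2 * L" using \<eta>L assms by linarith
  then have c2: "a * \<mu> + a * b - a^2 - 2 * L < 0"
    by (simp add: a_def algebra_simps power2_eq_square)
  note b(2)
  also have "b * \<mu> \<le> b * (\<mu> + a - b)" using b \<eta> by (intro mult_left_mono) (auto simp: a_def)
  finally have c3: "C - b / 2 * (\<mu> + a - b) < 0" by (simp add: algebra_simps)
  have "C \<le> \<mu> / 2 * b" using b by (simp add: mult.commute)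
  also have "\<mu> / 2 * b \<le> a * b" using a b by (intro mult_right_mono) auto
  finally have ab: "a * b \<ge> C" .

  have lim: "\<forall>\<^sub>F \<gamma> in at_right 0. q \<gamma> < 0" if "continuous_on UNIV q" "q 0 < 0" for q :: "real \<Rightarrow> real"
  proof (rule order_tendstoD(2))
    show "(q \<longlongrightarrow> q 0) (at_right 0)"
      using that(1) by (auto simp: continuous_on_eq_continuous_within continuous_def
          intro: tendsto_mono[OF at_le])
  qed fact
  have 1: "\<forall>\<^sub>F \<gamma> in at_right 0. - 1 + \<gamma> * (b / 2 - a) + \<gamma>^2 * C + \<gamma>^3 * (C * a / 2) < 0"
    by (rule lim) (auto intro!: continuous_intros)
  have 2: "\<forall>\<^sub>F \<gamma> in at_right 0. a * \<mu> + a * b - a^2 - 2 * L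
          + \<gamma> * (b * \<sigma> / 2 + a * (2 * C - \<mu> * b + \<mu> * a) - 2 * L * (a - b / 2))
          + \<gamma>^2 * C * (\<sigma> + a^2 - 2 * a * \<mu> + 2 * L)
          + \<gamma>^3 * C * a * (\<sigma> / 2 - a * \<mu> + L) < 0"
    using c2 by (intro lim) (auto intro!: continuous_intros)
  have 3: "\<forall>\<^sub>F \<gamma> in at_right 0. C - b / 2 * (\<mu> + a - b)
          + \<gamma> * (b * \<mu>^2 / 2 + C * a / 2 - 2 * C * \<mu> + b * a * \<mu> / 2 - b^2 * \<mu> / 2 + C * b)
          + \<gamma>^2 * C * (\<mu>^2 - a * \<mu> + b * a / 2 - b * \<mu>)
          + \<gamma>^3 * (C * a * \<mu> / 2) * (\<mu> - b) < 0"
    using c3 by (intro lim) (auto intro!: continuous_intros)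
  have 4: "\<forall>\<^sub>F \<gamma> in at_right 0. - msgd_delta C \<mu> \<gamma> a b < 0"
    unfolding msgd_delta_def by (rule lim) (auto intro!: continuous_intros)
  have 5: "\<forall>\<^sub>F \<gamma> in at_right 0. \<gamma> * C - b < 0"
    using b by (intro lim) (auto intro!: continuous_intros)
  \<comment> \<open>Continuity of \<open>\<delta>\<close> cannot give \<open>\<delta> < 1\<close>,
    because \<open>\<delta>\<close> is 1 at \<open>\<gamma> = 0\<close>. The quotient
    \<open>(\<delta> - 1) / \<gamma>\<close> is used instead; its limit is
    \<open>- \<eta>\<close>.\<close>
  have 6: "\<forall>\<^sub>F \<gamma> in at_right 0. (a - \<mu> - b) + \<gamma> * (b * \<mu> - a * \<mu> - 2 * C)
       + \<gamma>^2 * (2 * C * \<mu> - C * a) + \<gamma>^3 * C * a * \<mu> < 0"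
    using \<eta> by (intro lim) (auto intro!: continuous_intros simp: a_def)
  have "\<forall>\<^sub>F \<gamma> in at_right 0. msgd_conditions C L \<sigma> \<mu> \<gamma> a b \<and> msgd_delta C \<mu> \<gamma> a b < 1"
    using 1 2 3 4 5 6 eventually_at_right_less[of "0::real"]
  proof eventually_elim
    case (elim \<gamma>)
    have "msgd_delta C \<mu> \<gamma> a b - 1 = \<gamma> * ((a - \<mu> - b) + \<gamma> * (b * \<mu> - a * \<mu> - 2 * C)
       + \<gamma>^2 * (2 * C * \<mu> - C * a) + \<gamma>^3 * C * a * \<mu>)"
      unfolding msgd_delta_def by algebra
    also have "\<dots> < 0" using elim(6,7) by (rule mult_pos_neg[rotated])
    finally have "msgd_delta C \<mu> \<gamma> a b < 1" by simp
    moreover have "a \<ge> 0" using a \<open>\<mu> > 0\<close> by linarith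
    ultimately show ?case
      using elim ab b unfolding msgd_conditions_def by (intro conjI) linarith+
  qed
  then show thesis by (rule that)
qed

section \<open>Geometric decay\<close>

text \<open>Unrolling the second recursion produces \<open>n\<close> terms with factors
  \<open>q ^ (n - k) * d ^ k\<close>, each at most \<open>max q d ^ n\<close>. Counting them gives
  the linear factor and keeps the bound valid when \<open>q = d\<close>.\<close>

lemma coupled_recursion_bound:
  fixes e \<phi> :: "nat \<Rightarrow> real"
  assumes q: "q > 0" and d: "d \<ge> 0" and c: "c \<ge> 0" and e0: "e 0 \<ge> 0" and \<phi>0: "\<phi> 0 \<ge> 0"
    and e: "\<And>n. e (Suc n) \<le> d * e n"
    and \<phi>: "\<And>n. \<phi> (Suc n) \<le> q * (\<phi> n + c * e (Suc n))"
  shows "e n \<le> e 0 * (max q d) ^ n"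
    and "\<phi> n \<le> (\<phi> 0 + q * c * e 0 * real n) * (max q d) ^ n"
proof -
  let ?\<rho> = "max q d"
  have e_le: "e n \<le> e 0 * d ^ n" for n
  proof (induction n)
    case (Suc n)
    have "e (Suc n) \<le> d * e n" by (rule e)
    also have "\<dots> \<le> d * (e 0 * d ^ n)" using Suc d by (rule mult_left_mono)
    finally show ?case by (simp add: mult_ac)
  qed simp
  show e_bound: "e n \<le> e 0 * ?\<rho> ^ n" for n
    using e_le[of n] mult_left_mono[OF power_mono[of d ?\<rho> n] e0] d by simp
  show "\<phi> n \<le> (\<phi> 0 + q * c * e 0 * real n) * ?\<rho> ^ n"
  proof (induction n)
    case (Suc n)
    have "\<phi> (Suc n) \<le> q * (\<phi> n + c * e (Suc n))" by (rule \<phi>)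
    also have "\<dots> \<le> q * ((\<phi> 0 + q * c * e 0 * real n) * ?\<rho> ^ n + c * (e 0 * ?\<rho> ^ Suc n))"
      using Suc e_bound[of "Suc n"] q c by (intro mult_left_mono add_mono) auto
    also have "\<dots> = q * (\<phi> 0 + q * c * e 0 * real n) * ?\<rho> ^ n + q * c * e 0 * ?\<rho> ^ Suc n"
      by (simp add: algebra_simps)
    also have "\<dots> \<le> ?\<rho> * (\<phi> 0 + q * c * e 0 * real n) * ?\<rho> ^ n + q * c * e 0 * ?\<rho> ^ Suc n"
      using q c e0 \<phi>0 by (intro add_right_mono mult_right_mono) (auto intro!: add_nonneg_nonneg)
    also have "\<dots> = (\<phi> 0 + q * c * e 0 * real (Suc n)) * ?\<rho> ^ Suc n"
      by (simp add: algebra_simps)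
    finally show ?case .
  qed simp
qed

lemma summable_affine_geometric:
  fixes x :: real
  assumes "0 \<le> x" "x < 1"
  shows "summable (\<lambda>n. (c + d * real n) * x ^ n)"
proof -
  \<comment> \<open>The coefficients \<open>diffs (\<lambda>_. 1) n\<close> are
    \<open>n + 1\<close>: this is the termwise derivative of the geometric series. The claim follows
    from \<open>c + d * n = (c - d) + d * (n + 1)\<close>.\<close>
  have "summable (\<lambda>n. diffs (\<lambda>_. 1) n * x ^ n)"
    using assms by (intro termdiff_converges[of x 1]) (auto intro: summable_geometric)
  then have "summable (\<lambda>n. (c - d) * x ^ n + d * (diffs (\<lambda>_. 1) n * x ^ n))"
    using assms by (intro summable_add summable_mult summable_geometric) auto
  then show ?thesis by (simp add: diffs_def algebra_simps)
qed

section \<open>Square integrable random vectors\<close>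

lemma norm_add_scaleR_squared:
  fixes v d :: "'a::real_inner"
  shows "(norm (v + g *\<^sub>R d))\<^sup>2 = (norm v)\<^sup>2 + g\<^sup>2 * (norm d)\<^sup>2 + 2 * g * (v \<bullet> d)"
  unfolding power2_norm_eq_inner
  by (simp add: inner_add_left inner_add_right inner_commute[of d v] power2_eq_square algebra_simps)

lemma norm_scaleR_diff_squared:
  fixes v d :: "'a::real_inner"
  shows "(norm (c *\<^sub>R v - g *\<^sub>R d))\<^sup>2 = c\<^sup>2 * (norm v)\<^sup>2 - 2 * g * c * (d \<bullet> v) + g\<^sup>2 * (norm d)\<^sup>2"
  unfolding power2_norm_eq_inner
  by (simp add: inner_diff_left inner_diff_right inner_commute[of v d] power2_eq_square algebra_simps)

lemma integrable_indicator_mult: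
  fixes g :: "'w \<Rightarrow> real"
  assumes "A \<in> sets M" "integrable M g"
  shows "integrable M (\<lambda>\<omega>. indicator A \<omega> * g \<omega>)"
  using integrable_mult_indicator[OF assms] by simp

lemma square_integrable_cong:
  assumes "\<And>\<omega>. \<omega> \<in> space M \<Longrightarrow> Y \<omega> = Z \<omega>"
  shows "square_integrable M Y \<longleftrightarrow> square_integrable M Z"
  unfolding square_integrable_def
  using assms by (intro conj_cong measurable_cong Bochner_Integration.integrable_cong) auto

lemma square_integrable_add:
  assumes "square_integrable M Y" "square_integrable M Z"
  shows "square_integrable M (\<lambda>\<omega>. Y \<omega> + Z \<omega>)"
proof -
  have [measurable]: "Y \<in> borel_measurable M" "Z \<in> borel_measurable M"
    using assms by (auto simp: square_integrable_def)
  have "(norm (y + z))\<^sup>2 \<le> 2 * (norm y)\<^sup>2 + 2 * (norm z)\<^sup>2" for y z :: 'b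
    using zero_le_power2[of "norm (y - z)"]
    by (simp add: power2_norm_eq_inner inner_simps inner_commute)
  moreover have "integrable M (\<lambda>\<omega>. 2 * (norm (Y \<omega>))\<^sup>2 + 2 * (norm (Z \<omega>))\<^sup>2)"
    using assms by (auto simp: square_integrable_def)
  ultimately have "integrable M (\<lambda>\<omega>. (norm (Y \<omega> + Z \<omega>))\<^sup>2)"
    by (elim Bochner_Integration.integrable_bound) auto
  then show ?thesis by (simp add: square_integrable_def)
qed

lemma square_integrable_scaleR:
  assumes "square_integrable M Y"
  shows "square_integrable M (\<lambda>\<omega>. c *\<^sub>R Y \<omega>)"
  using assms by (auto simp: square_integrable_def power_mult_distrib)

lemma square_integrable_diff:
  assumes "square_integrable M Y" "square_integrable M Z"
  shows "square_integrable M (\<lambda>\<omega>. Y \<omega> - Z \<omega>)"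
  using square_integrable_add[OF assms(1) square_integrable_scaleR[OF assms(2), of "-1"]] by simp

lemma square_integrable_indicator:
  assumes "A \<in> sets M" "square_integrable M Y"
  shows "square_integrable M (\<lambda>\<omega>. indicator A \<omega> *\<^sub>R Y \<omega>)"
proof -
  have [measurable]: "Y \<in> borel_measurable M" "A \<in> sets M"
    using assms by (auto simp: square_integrable_def)
  have "integrable M (\<lambda>\<omega>. (norm (indicator A \<omega> *\<^sub>R Y \<omega>))\<^sup>2)"
    using assms(2) unfolding square_integrable_def
    by (elim conjE Bochner_Integration.integrable_bound) (auto split: split_indicator)
  then show ?thesis by (simp add: square_integrable_def)
qed

lemma integrable_inner_square_integrable:
  assumes "square_integrable M Y" "square_integrable M Z"
  shows "integrable M (\<lambda>\<omega>. Y \<omega> \<bullet> Z \<omega>)"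
proof -
  have [measurable]: "Y \<in> borel_measurable M" "Z \<in> borel_measurable M"
    using assms by (auto simp: square_integrable_def)
  have "\<bar>y \<bullet> z\<bar> \<le> (norm y)\<^sup>2 + (norm z)\<^sup>2" for y z :: 'b
  proof -
    have "\<bar>y \<bullet> z\<bar> \<le> norm y * norm z" by (rule Cauchy_Schwarz_ineq2)
    also have "\<dots> \<le> (norm y)\<^sup>2 + (norm z)\<^sup>2"
      using sum_squares_bound[of "norm y" "norm z"] mult_nonneg_nonneg[OF norm_ge_zero norm_ge_zero, of y z]
      unfolding mult.assoc by linarith
    finally show ?thesis .
  qed
  moreover have "integrable M (\<lambda>\<omega>. (norm (Y \<omega>))\<^sup>2 + (norm (Z \<omega>))\<^sup>2)"
    using assms by (auto simp: square_integrable_def)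
  ultimately show ?thesis
    by (elim Bochner_Integration.integrable_bound) auto
qed

text \<open>The difference to \<open>g 0\<close> grows at most linearly, and the constant
  \<open>g 0\<close> is square integrable because the measure is finite.\<close>

lemma (in finite_measure) square_integrable_lipschitz:
  fixes g :: "'b::euclidean_space \<Rightarrow> 'c::euclidean_space"
  assumes lip: "C-lipschitz_on UNIV g" and Y: "square_integrable M Y"
  shows "square_integrable M (\<lambda>\<omega>. g (Y \<omega>))"
proof -
  have [measurable]: "Y \<in> borel_measurable M" "g \<in> borel_measurable borel"
    using Y lipschitz_on_continuous_on[OF lip]
    by (auto simp: square_integrable_def intro: borel_measurable_continuous_onI)
  have "square_integrable M (\<lambda>\<omega>. g (Y \<omega>) - g 0)"
  proof -
    have "norm (g y - g 0) \<le> C * norm y" for y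
      using lipschitz_onD[OF lip, of y 0] by (simp add: dist_norm)
    then have "(norm (g y - g 0))\<^sup>2 \<le> C\<^sup>2 * (norm y)\<^sup>2" for y
      unfolding power_mult_distrib[symmetric] by (intro power_mono) auto
    moreover have "integrable M (\<lambda>\<omega>. C\<^sup>2 * (norm (Y \<omega>))\<^sup>2)"
      using Y by (auto simp: square_integrable_def)
    ultimately have "integrable M (\<lambda>\<omega>. (norm (g (Y \<omega>) - g 0))\<^sup>2)"
      by (elim Bochner_Integration.integrable_bound) auto
    then show ?thesis by (simp add: square_integrable_def)
  qed
  moreover have "square_integrable M (\<lambda>\<omega>. g 0)"
    by (simp add: square_integrable_def)
  ultimately show ?thesis
    using square_integrable_add[of M "\<lambda>\<omega>. g (Y \<omega>) - g 0" "\<lambda>\<omega>. g 0"] by simp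
qed

text \<open>By monotone convergence the sum of the \<open>g n\<close> has finite integral, hence is
  finite almost everywhere.\<close>

lemma AE_summable_of_summable_integral:
  fixes g :: "nat \<Rightarrow> 'w \<Rightarrow> real"
  assumes int: "\<And>n. integrable M (g n)" and nonneg: "\<And>n \<omega>. g n \<omega> \<ge> 0"
    and sum: "summable (\<lambda>n. \<integral>\<omega>. g n \<omega> \<partial>M)"
  shows "AE \<omega> in M. summable (\<lambda>n. g n \<omega>)"
proof -
  have [measurable]: "g n \<in> borel_measurable M" for n
    using int by (rule borel_measurable_integrable)
  have "(\<integral>\<^sup>+\<omega>. (\<Sum>n. ennreal (g n \<omega>)) \<partial>M) = (\<Sum>n. \<integral>\<^sup>+\<omega>. ennreal (g n \<omega>) \<partial>M)"
    by (rule nn_integral_suminf) measurable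
  also have "\<dots> = (\<Sum>n. ennreal (\<integral>\<omega>. g n \<omega> \<partial>M))"
    using int nonneg by (intro suminf_cong nn_integral_eq_integral) auto
  also have "\<dots> = ennreal (\<Sum>n. \<integral>\<omega>. g n \<omega> \<partial>M)"
    using sum nonneg by (intro suminf_ennreal2) auto
  finally have "(\<integral>\<^sup>+\<omega>. (\<Sum>n. ennreal (g n \<omega>)) \<partial>M) \<noteq> \<infinity>" by simp
  then have "AE \<omega> in M. (\<Sum>n. ennreal (g n \<omega>)) \<noteq> \<infinity>"
    by (intro nn_integral_PInf_AE) measurable
  then show ?thesis
    by eventually_elim (auto intro!: summable_suminf_not_top nonneg)
qed

lemma integral_indicator_cmult:
  fixes g :: "'w \<Rightarrow> real"
  shows "(\<integral>\<omega>. indicator A \<omega> * (c * g \<omega>) \<partial>M) = c * (\<integral>\<omega>. indicator A \<omega> * g \<omega> \<partial>M)"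
  by (subst integral_mult_right_zero[symmetric]) (simp add: mult.left_commute)

text \<open>Three terms match the shape of the Lyapunov function; shorter combinations are padded
  with a zero coefficient before it is applied.\<close>

lemma integral_indicator_lincomb:
  fixes g h k :: "'w \<Rightarrow> real"
  assumes A: "A \<in> sets M" and int: "integrable M g" "integrable M h" "integrable M k"
  shows "(\<integral>\<omega>. indicator A \<omega> * (x * g \<omega> + y * h \<omega> + z * k \<omega>) \<partial>M)
    = x * (\<integral>\<omega>. indicator A \<omega> * g \<omega> \<partial>M) + y * (\<integral>\<omega>. indicator A \<omega> * h \<omega> \<partial>M)
      + z * (\<integral>\<omega>. indicator A \<omega> * k \<omega> \<partial>M)"
proof -
  note int' = int[THEN integrable_indicator_mult[OF A]]
  have "(\<integral>\<omega>. indicator A \<omega> * (x * g \<omega> + y * h \<omega> + z * k \<omega>) \<partial>M)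
    = (\<integral>\<omega>. x * (indicator A \<omega> * g \<omega>) + y * (indicator A \<omega> * h \<omega>) + z * (indicator A \<omega> * k \<omega>) \<partial>M)"
    by (intro Bochner_Integration.integral_cong) (auto simp: algebra_simps)
  then show ?thesis
    by (simp only: Bochner_Integration.integral_add Bochner_Integration.integrable_add
        integral_mult_right_zero integrable_mult_right int')
qed

section \<open>Averaging over events of the filtration\<close>

context filtered_prob_space
begin

lemma sigma_finite_subalgebra_F: "sigma_finite_subalgebra M (F n)"
  by (intro finite_measure_subalgebra_is_sigma_finite finite_measure_subalgebra.intro
      finite_measure_subalgebra_axioms.intro finite_measure_axioms subalgebra_F)

lemma sets_F_imp_sets: "A \<in> sets (F n) \<Longrightarrow> A \<in> sets M"
  using subalgebra_F[of n] by (auto simp: subalgebra_def)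

text \<open>In each coordinate, the \<open>F n\<close>-measurable factor from \<open>W\<close> is
  kept while the increment is replaced by its conditional expectation, which vanishes.\<close>

lemma integral_inner_martingale_difference:
  fixes W :: "'w \<Rightarrow> 'b::euclidean_space"
  assumes D: "L2_martingale_differences M F D"
    and W: "W \<in> borel_measurable (F n)" "square_integrable M W"
  shows "(\<integral>\<omega>. W \<omega> \<bullet> D (Suc n) \<omega> \<partial>M) = 0"
proof -
  have D2: "square_integrable M (D (Suc n))"
    and D0: "\<And>i. i \<in> Basis \<Longrightarrow> AE \<omega> in M. real_cond_exp M (F n) (\<lambda>\<omega>. D (Suc n) \<omega> \<bullet> i) \<omega> = 0"
    using D by (auto simp: L2_martingale_differences_def)
  have [measurable]: "D (Suc n) \<in> borel_measurable M" "W \<in> borel_measurable M"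
    using D2 W by (auto simp: square_integrable_def)
  have coord: "integrable M (\<lambda>\<omega>. (W \<omega> \<bullet> i) * (D (Suc n) \<omega> \<bullet> i))" 
      "(\<integral>\<omega>. (W \<omega> \<bullet> i) * (D (Suc n) \<omega> \<bullet> i) \<partial>M) = 0" if i: "i \<in> Basis" for i
  proof -
    \<comment> \<open>Turning the coordinate back into a vector along \<open>i\<close> makes its
      inner product with \<open>W\<close> the desired product of coordinates, so that integrability
      of inner products applies.\<close>
    have "square_integrable M (\<lambda>\<omega>. (D (Suc n) \<omega> \<bullet> i) *\<^sub>R i)"
    proof -
      have "((D (Suc n) \<omega> \<bullet> i))\<^sup>2 \<le> (norm (D (Suc n) \<omega>))\<^sup>2" for \<omega>
        using Basis_le_norm[OF i, of "D (Suc n) \<omega>"] by (metis abs_ge_zero power2_abs power_mono)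
      then have "integrable M (\<lambda>\<omega>. (norm ((D (Suc n) \<omega> \<bullet> i) *\<^sub>R i))\<^sup>2)"
        using D2 i unfolding square_integrable_def
        by (elim conjE Bochner_Integration.integrable_bound) (auto simp: power_mult_distrib)
      then show ?thesis by (simp add: square_integrable_def)
    qed
    from integrable_inner_square_integrable[OF W(2) this]
    show int: "integrable M (\<lambda>\<omega>. (W \<omega> \<bullet> i) * (D (Suc n) \<omega> \<bullet> i))" by (simp add: mult.commute)
    have "(\<lambda>\<omega>. W \<omega> \<bullet> i) \<in> borel_measurable (F n)" using W(1) by simp
    then have "(\<integral>\<omega>. (W \<omega> \<bullet> i) * (D (Suc n) \<omega> \<bullet> i) \<partial>M)
        = (\<integral>\<omega>. (W \<omega> \<bullet> i) * real_cond_exp M (F n) (\<lambda>\<omega>. D (Suc n) \<omega> \<bullet> i) \<omega> \<partial>M)"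
      using sigma_finite_subalgebra.real_cond_exp_intg(2)[OF sigma_finite_subalgebra_F int] by simp
    also have "\<dots> = 0"
      using D0[OF i] by (intro integral_eq_zero_AE) auto
    finally show "(\<integral>\<omega>. (W \<omega> \<bullet> i) * (D (Suc n) \<omega> \<bullet> i) \<partial>M) = 0" .
  qed
  have "(\<integral>\<omega>. W \<omega> \<bullet> D (Suc n) \<omega> \<partial>M) = (\<integral>\<omega>. (\<Sum>i\<in>Basis. (W \<omega> \<bullet> i) * (D (Suc n) \<omega> \<bullet> i)) \<partial>M)"
    by (intro Bochner_Integration.integral_cong refl euclidean_inner)
  also have "\<dots> = (\<Sum>i\<in>Basis. \<integral>\<omega>. (W \<omega> \<bullet> i) * (D (Suc n) \<omega> \<bullet> i) \<partial>M)"
    using coord(1) by (rule Bochner_Integration.integral_sum)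
  also have "\<dots> = 0" using coord(2) by simp
  finally show ?thesis .
qed

text \<open>Over an event of \<open>F n\<close> the integral of \<open>g\<close> equals that of its
  conditional expectation. In this form the noise assumption enters the mean estimates.\<close>

lemma integral_indicator_le_of_cond_exp_le:
  fixes g h :: "'w \<Rightarrow> real"
  assumes A: "A \<in> sets (F n)" and g: "integrable M g" and h: "integrable M h"
    and le: "AE \<omega> in M. \<omega> \<in> A \<longrightarrow> real_cond_exp M (F n) g \<omega> \<le> h \<omega>"
  shows "(\<integral>\<omega>. indicator A \<omega> * g \<omega> \<partial>M) \<le> (\<integral>\<omega>. indicator A \<omega> * h \<omega> \<partial>M)"
proof -
  have A': "A \<in> sets M" using A by (rule sets_F_imp_sets)
  note * = sigma_finite_subalgebra.real_cond_exp_intg[OF sigma_finite_subalgebra_F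
      integrable_indicator_mult[OF A' g], of n]
  have "(\<integral>\<omega>. indicator A \<omega> * g \<omega> \<partial>M) = (\<integral>\<omega>. indicator A \<omega> * real_cond_exp M (F n) g \<omega> \<partial>M)"
    using *(2) A g by (simp add: borel_measurable_integrable)
  also have "\<dots> \<le> (\<integral>\<omega>. indicator A \<omega> * h \<omega> \<partial>M)"
    using le *(1) A g integrable_indicator_mult[OF A' h]
    by (intro integral_mono_AE) (auto simp: borel_measurable_integrable split: split_indicator)
  finally show ?thesis .
qed

end

section \<open>One step of the process\<close>

context msgd
begin

lemma C_nonneg: "C\<^sub>L \<ge> 0"
  using gradient_lipschitz by (rule lipschitz_on_nonneg)

lemma f_nonneg: "f x \<ge> 0"
  using cINF_lower[OF f_bdd_below, of x] f_inf by simp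

lemma gradient_norm_le: "(norm (df x))\<^sup>2 \<le> 2 * C\<^sub>L * f x"
  by (rule gradient_norm_le_of_nonneg[OF gradient gradient_lipschitz f_nonneg])

lemma df_borel [measurable]: "df \<in> borel_measurable borel"
  by (intro borel_measurable_continuous_onI lipschitz_on_continuous_on[OF gradient_lipschitz])

lemma f_borel [measurable]: "f \<in> borel_measurable borel"
  using gradient unfolding gderiv_def
  by (intro borel_measurable_continuous_onI)
     (auto intro!: continuous_at_imp_continuous_on has_derivative_continuous)

lemma D_L2: "square_integrable M (D (Suc n))"
  using D_mart_diff by (simp add: L2_martingale_differences_def)

lemma df_L2: "square_integrable M Y \<Longrightarrow> square_integrable M (\<lambda>\<omega>. df (Y \<omega>))"
  by (rule square_integrable_lipschitz[OF gradient_lipschitz])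

text \<open>The new velocity comes first in the induction step, because the position update uses
  it.\<close>

lemma X_V_L2: "square_integrable M (X n) \<and> square_integrable M (V n)"
proof (induction n)
  case 0
  then show ?case using X0_L2 V0_L2 by simp
next
  case (Suc n)
  have V: "square_integrable M (V (Suc n))"
    using Suc D_L2[of n]
    by (intro iffD2[OF square_integrable_cong[OF V_step]] square_integrable_add square_integrable_diff square_integrable_scaleR df_L2) auto
  have "square_integrable M (X (Suc n))"
    using Suc V by (intro iffD2[OF square_integrable_cong[OF X_step]] square_integrable_add square_integrable_scaleR) auto
  then show ?case using V by simp
qed

lemmas X_L2 = X_V_L2[THEN conjunct1] and V_L2 = X_V_L2[THEN conjunct2]

lemma X_borel [measurable]: "X n \<in> borel_measurable M"
  using X_L2[of n] by (simp add: square_integrable_def)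

text \<open>The descent lemma at 0 dominates the nonnegative \<open>f\<close> by a quadratic
  polynomial.\<close>

lemma integrable_f_X: "integrable M (\<lambda>\<omega>. f (X n \<omega>))"
proof (rule Bochner_Integration.integrable_bound)
  show "integrable M (\<lambda>\<omega>. f 0 + df 0 \<bullet> X n \<omega> + C\<^sub>L / 2 * (norm (X n \<omega>))\<^sup>2)"
    using X_L2[of n] integrable_inner_square_integrable[of M "\<lambda>_. df 0" "X n"]
    by (auto simp: square_integrable_def)
  show "AE \<omega> in M. norm (f (X n \<omega>)) \<le> norm (f 0 + df 0 \<bullet> X n \<omega> + C\<^sub>L / 2 * (norm (X n \<omega>))\<^sup>2)"
    using lipschitz_gradient_upper_bound[OF gradient gradient_lipschitz, of 0] f_nonneg
    by (intro AE_I2) (smt (verit) add_0 real_norm_def)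
  show "(\<lambda>\<omega>. f (X n \<omega>)) \<in> borel_measurable M"
    by measurable
qed

lemma integrable_norm_V: "integrable M (\<lambda>\<omega>. (norm (V n \<omega>))\<^sup>2)"
  using V_L2[of n] by (simp add: square_integrable_def)

lemma integrable_norm_D: "integrable M (\<lambda>\<omega>. (norm (D (Suc n) \<omega>))\<^sup>2)"
  using D_L2[of n] by (simp add: square_integrable_def)

lemma integrable_inner_df_V: "integrable M (\<lambda>\<omega>. df (X n \<omega>) \<bullet> V k \<omega>)"
  by (intro integrable_inner_square_integrable df_L2 X_L2 V_L2)

text \<open>The conditional mean of \<open>V (Suc n)\<close> given \<open>F n\<close>: the new
  velocity without its noise term.\<close>

definition drift :: "nat \<Rightarrow> 'w \<Rightarrow> 'a" where
  "drift n \<omega> = (1 - \<gamma> (Suc n) * \<mu>) *\<^sub>R V n \<omega> - \<gamma> (Suc n) *\<^sub>R df (X n \<omega>)"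

lemma V_step_drift:
  "\<omega> \<in> space M \<Longrightarrow> V (Suc n) \<omega> = drift n \<omega> + \<gamma> (Suc n) *\<^sub>R D (Suc n) \<omega>"
  by (simp add: V_step drift_def scaleR_left_diff_distrib)

lemma drift_L2: "square_integrable M (drift n)"
  unfolding drift_def
  by (intro square_integrable_diff square_integrable_scaleR df_L2 X_L2 V_L2)

lemma drift_adapted: "drift n \<in> borel_measurable (F n)"
  unfolding drift_def
  by (intro borel_measurable_diff borel_measurable_scaleR borel_measurable_const
      measurable_compose[OF X_adapted df_borel] V_adapted)

lemma norm_drift:
  "(norm (drift n \<omega>))\<^sup>2 = (1 - \<gamma> (Suc n) * \<mu>)\<^sup>2 * (norm (V n \<omega>))\<^sup>2
     - 2 * \<gamma> (Suc n) * (1 - \<gamma> (Suc n) * \<mu>) * (df (X n \<omega>) \<bullet> V n \<omega>)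
     + (\<gamma> (Suc n))\<^sup>2 * (norm (df (X n \<omega>)))\<^sup>2"
  unfolding drift_def by (rule norm_scaleR_diff_squared)

lemma inner_drift:
  "df (X n \<omega>) \<bullet> drift n \<omega> = (1 - \<gamma> (Suc n) * \<mu>) * (df (X n \<omega>) \<bullet> V n \<omega>)
     - \<gamma> (Suc n) * (norm (df (X n \<omega>)))\<^sup>2"
  unfolding drift_def power2_norm_eq_inner by (simp add: inner_diff_right)

text \<open>The event and the gradient at \<open>X n\<close> are known at time \<open>n\<close>, so
  the noise averages out.\<close>

lemma integral_inner_V_Suc:
  assumes A: "A \<in> sets (F n)"
  shows "(\<integral>\<omega>. indicator A \<omega> * (df (X n \<omega>) \<bullet> V (Suc n) \<omega>) \<partial>M)
       = (\<integral>\<omega>. indicator A \<omega> * (df (X n \<omega>) \<bullet> drift n \<omega>) \<partial>M)"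
proof -
  have A': "A \<in> sets M" using A by (rule sets_F_imp_sets)
  let ?W = "\<lambda>\<omega>. indicator A \<omega> *\<^sub>R df (X n \<omega>)"
  have W: "?W \<in> borel_measurable (F n)" "square_integrable M ?W"
    using A measurable_compose[OF X_adapted df_borel, of n]
    by (auto intro!: square_integrable_indicator A' df_L2 X_L2)
  have "(\<integral>\<omega>. indicator A \<omega> * (df (X n \<omega>) \<bullet> V (Suc n) \<omega>) \<partial>M)
      = (\<integral>\<omega>. indicator A \<omega> * (df (X n \<omega>) \<bullet> drift n \<omega>) + \<gamma> (Suc n) * (?W \<omega> \<bullet> D (Suc n) \<omega>) \<partial>M)"
    by (intro Bochner_Integration.integral_cong) (auto simp: V_step_drift inner_add_right algebra_simps)
  also have "\<dots> = (\<integral>\<omega>. indicator A \<omega> * (df (X n \<omega>) \<bullet> drift n \<omega>) \<partial>M)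
      + \<gamma> (Suc n) * (\<integral>\<omega>. ?W \<omega> \<bullet> D (Suc n) \<omega> \<partial>M)"
    using W(2) by (subst Bochner_Integration.integral_add)
      (auto intro!: integrable_indicator_mult A' integrable_mult_right
         integrable_inner_square_integrable df_L2 X_L2 drift_L2 D_L2 simp del: inner_scaleR_left)
  finally show ?thesis
    using integral_inner_martingale_difference[OF D_mart_diff W] by simp
qed

text \<open>The drift restricted to \<open>A\<close> is orthogonal to the noise, so only the two
  squares survive.\<close>

lemma integral_norm_V_Suc:
  assumes A: "A \<in> sets (F n)"
  shows "(\<integral>\<omega>. indicator A \<omega> * (norm (V (Suc n) \<omega>))\<^sup>2 \<partial>M)
       = (\<integral>\<omega>. indicator A \<omega> * (norm (drift n \<omega>))\<^sup>2 \<partial>M)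
         + (\<gamma> (Suc n))\<^sup>2 * (\<integral>\<omega>. indicator A \<omega> * (norm (D (Suc n) \<omega>))\<^sup>2 \<partial>M)"
proof -
  have A': "A \<in> sets M" using A by (rule sets_F_imp_sets)
  let ?W = "\<lambda>\<omega>. indicator A \<omega> *\<^sub>R drift n \<omega>"
  let ?g = "\<gamma> (Suc n)"
  have W: "?W \<in> borel_measurable (F n)" "square_integrable M ?W"
    using A drift_adapted by (auto intro!: square_integrable_indicator A' drift_L2)
  have int: "integrable M (\<lambda>\<omega>. indicator A \<omega> * (norm (drift n \<omega>))\<^sup>2)"
    "integrable M (\<lambda>\<omega>. ?g\<^sup>2 * (indicator A \<omega> * (norm (D (Suc n) \<omega>))\<^sup>2))"
    "integrable M (\<lambda>\<omega>. 2 * ?g * (?W \<omega> \<bullet> D (Suc n) \<omega>))"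
    using drift_L2[of n] integrable_norm_D[of n] integrable_inner_square_integrable[OF W(2) D_L2]
    by (auto intro!: integrable_indicator_mult A' integrable_mult_right
        simp: square_integrable_def simp del: inner_scaleR_left)
  have "(\<integral>\<omega>. indicator A \<omega> * (norm (V (Suc n) \<omega>))\<^sup>2 \<partial>M)
      = (\<integral>\<omega>. indicator A \<omega> * (norm (drift n \<omega>))\<^sup>2
           + ?g\<^sup>2 * (indicator A \<omega> * (norm (D (Suc n) \<omega>))\<^sup>2) + 2 * ?g * (?W \<omega> \<bullet> D (Suc n) \<omega>) \<partial>M)"
    by (intro Bochner_Integration.integral_cong)
       (simp_all add: V_step_drift norm_add_scaleR_squared distrib_left)
  also have "\<dots> = (\<integral>\<omega>. indicator A \<omega> * (norm (drift n \<omega>))\<^sup>2 \<partial>M)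
      + (\<integral>\<omega>. ?g\<^sup>2 * (indicator A \<omega> * (norm (D (Suc n) \<omega>))\<^sup>2) \<partial>M)
      + (\<integral>\<omega>. 2 * ?g * (?W \<omega> \<bullet> D (Suc n) \<omega>) \<partial>M)"
    by (simp only: Bochner_Integration.integral_add Bochner_Integration.integrable_add int)
  finally show ?thesis
    using integral_inner_martingale_difference[OF D_mart_diff W]
    by (simp only: integral_mult_right_zero mult_zero_right add_0_right)
qed

end

section \<open>The Lyapunov function\<close>

text \<open>The hypotheses of the two convergence claims, gathered in one context; positivity of
  \<open>\<gamma>\<close> is inherited from \<open>step_pos\<close>.\<close>

locale msgd_pl_domain = msgd M F f df C\<^sub>L \<mu> "\<lambda>_. \<gamma>" X V D
  for M :: "'w measure" and F :: "nat \<Rightarrow> 'w measure"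
    and f :: "'a::euclidean_space \<Rightarrow> real" and df :: "'a \<Rightarrow> 'a"
    and C\<^sub>L \<mu> \<gamma> :: real and X V D :: "nat \<Rightarrow> 'w \<Rightarrow> 'a" +
  fixes U :: "'a set" and L \<sigma> a b :: real
  assumes open_U: "open U"
    and PL: "x \<in> U \<Longrightarrow> 2 * L * f x \<le> (norm (df x))\<^sup>2"
    and noise: "AE \<omega> in M. \<omega> \<in> stay_event M X U n \<longrightarrow>
         real_cond_exp M (F n) (\<lambda>\<omega>. (norm (D (Suc n) \<omega>))\<^sup>2) \<omega> \<le> \<sigma> * f (X n \<omega>)"
    and cond: "msgd_conditions C\<^sub>L L \<sigma> \<mu> \<gamma> a b"
begin

abbreviation A :: "nat \<Rightarrow> 'w set" where "A n \<equiv> stay_event M X U n"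
abbreviation \<delta> :: real where "\<delta> \<equiv> msgd_delta C\<^sub>L \<mu> \<gamma> a b"

lemma gamma_pos: "\<gamma> > 0"
  by (rule step_pos)

lemma a_nonneg: "a \<ge> 0" and b_nonneg: "b \<ge> 0" and delta_nonneg: "\<delta> \<ge> 0"
  and ab_ge: "C\<^sub>L \<le> a * b" and gamma_le: "\<gamma> * C\<^sub>L \<le> b"
  using cond by (auto simp: msgd_conditions_def)

lemma A_antimono: "m \<le> n \<Longrightarrow> A n \<subseteq> A m"
  by (auto simp: stay_event_def)

lemma A_sets_F: "A n \<in> sets (F n)"
proof -
  have "X i -` U \<inter> space M \<in> sets (F n)" if "i \<le> n" for i
    using measurable_sets[OF X_adapted[of i], of U] open_U sets_F_mono[OF that]
    by (auto simp: space_F)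
  then have "(\<Inter>i\<in>{..n}. X i -` U \<inter> space M) \<in> sets (F n)"
    by (intro sets.finite_INT) auto
  also have "(\<Inter>i\<in>{..n}. X i -` U \<inter> space M) = A n"
    by (auto simp: stay_event_def)
  finally show ?thesis .
qed

lemma A_sets: "A n \<in> sets M"
  using A_sets_F by (rule sets_F_imp_sets)

section \<open>Pointwise estimates for the Lyapunov function\<close>

definition lyapunov :: "'a \<Rightarrow> 'a \<Rightarrow> real" where
  "lyapunov x v = a * f x + df x \<bullet> v + b / 2 * (norm v)\<^sup>2"

text \<open>Weighted Young inequality combined with the gradient bound. The weight \<open>t\<close>
  stays free: \<open>t = b\<close> yields nonnegativity of the Lyapunov function,
  \<open>t = b / 2\<close> leaves part of the velocity term over.\<close>

lemma inner_gradient_ge: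
  assumes "t > 0"
  shows "df x \<bullet> v \<ge> - (C\<^sub>L / t * f x) - t / 2 * (norm v)\<^sup>2"
proof -
  have "t * (2 * (norm (df x) * norm v)) \<le> (norm (df x))\<^sup>2 + t\<^sup>2 * (norm v)\<^sup>2"
    using zero_le_power2[of "norm (df x) - t * norm v"]
    by (simp add: power2_diff power_mult_distrib algebra_simps)
  also have "\<dots> \<le> 2 * C\<^sub>L * f x + t\<^sup>2 * (norm v)\<^sup>2"
    using gradient_norm_le by simp
  also have "\<dots> = t * (2 * (C\<^sub>L / t * f x + t / 2 * (norm v)\<^sup>2))"
    using assms by (simp add: field_simps power2_eq_square)
  finally have "norm (df x) * norm v \<le> C\<^sub>L / t * f x + t / 2 * (norm v)\<^sup>2"
    using assms by simp
  then show ?thesis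
    using Cauchy_Schwarz_ineq2[of "df x" v] by linarith
qed

lemma lyapunov_nonneg: "lyapunov x v \<ge> 0"
proof (cases "b = 0")
  \<comment> \<open>Without a velocity term, \<open>a * b \<ge> C\<^sub>L\<close> forces
    \<open>C\<^sub>L = 0\<close>, so the mixed term vanishes with the gradient.\<close>
  case True
  then have "C\<^sub>L = 0" using ab_ge C_nonneg by simp
  then have "df x = 0" using gradient_norm_le[of x] by simp
  then show ?thesis using a_nonneg b_nonneg f_nonneg by (simp add: lyapunov_def)
next
  case False
  then have b: "b > 0" using b_nonneg by simp
  then have "C\<^sub>L / b \<le> a" using ab_ge by (simp add: field_simps)
  then have "C\<^sub>L / b * f x \<le> a * f x" using f_nonneg by (rule mult_right_mono)
  then show ?thesis using inner_gradient_ge[OF b, of x v] by (simp add: lyapunov_def)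
qed

lemma norm_velocity_le_lyapunov:
  assumes b: "b > 0"
  shows "(norm v)\<^sup>2 \<le> 4 / b * (lyapunov x v + 2 * C\<^sub>L / b * f x)"
proof -
  have "df x \<bullet> v \<ge> - (2 * C\<^sub>L / b * f x) - b / 4 * (norm v)\<^sup>2"
    using inner_gradient_ge[of "b / 2" x v] b by (simp add: mult.commute)
  then have "b / 4 * (norm v)\<^sup>2 \<le> lyapunov x v + 2 * C\<^sub>L / b * f x"
    using mult_nonneg_nonneg[OF a_nonneg f_nonneg, of x] unfolding lyapunov_def by linarith
  then show ?thesis using b by (simp add: field_simps)
qed

text \<open>Moves the base point of \<open>f\<close> and \<open>df\<close> back to
  \<open>X n\<close>, so that the gradient becomes \<open>F n\<close>-measurable and the noise can
  be averaged out. The Lipschitz errors collect in the coefficient of the squared velocity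
  norm.\<close>

lemma lyapunov_step_le:
  assumes "\<omega> \<in> space M"
  shows "lyapunov (X (Suc n) \<omega>) (V (Suc n) \<omega>)
    \<le> a * f (X n \<omega>) + (1 + a * \<gamma>) * (df (X n \<omega>) \<bullet> V (Suc n) \<omega>)
      + (b / 2 + C\<^sub>L * \<gamma> + a * C\<^sub>L * \<gamma>\<^sup>2 / 2) * (norm (V (Suc n) \<omega>))\<^sup>2"
proof -
  let ?x = "X n \<omega>" and ?v = "V (Suc n) \<omega>"
  have X: "X (Suc n) \<omega> = ?x + \<gamma> *\<^sub>R ?v" using X_step[OF assms] .
  have "f (?x + \<gamma> *\<^sub>R ?v) \<le> f ?x + \<gamma> * (df ?x \<bullet> ?v) + C\<^sub>L / 2 * (\<gamma>\<^sup>2 * (norm ?v)\<^sup>2)"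
    using lipschitz_gradient_upper_bound[OF gradient gradient_lipschitz, of ?x "\<gamma> *\<^sub>R ?v"]
    by (simp add: power_mult_distrib)
  then have 1: "a * f (X (Suc n) \<omega>) \<le> a * (f ?x + \<gamma> * (df ?x \<bullet> ?v) + C\<^sub>L / 2 * (\<gamma>\<^sup>2 * (norm ?v)\<^sup>2))"
    unfolding X using a_nonneg by (rule mult_left_mono)
  have "(df (X (Suc n) \<omega>) - df ?x) \<bullet> ?v \<le> norm (df (X (Suc n) \<omega>) - df ?x) * norm ?v"
    by (rule norm_cauchy_schwarz)
  also have "\<dots> \<le> (C\<^sub>L * norm (\<gamma> *\<^sub>R ?v)) * norm ?v"
    using lipschitz_onD[OF gradient_lipschitz, of "?x + \<gamma> *\<^sub>R ?v" ?x] X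
    by (intro mult_right_mono) (auto simp: dist_norm)
  also have "\<dots> = C\<^sub>L * \<gamma> * (norm ?v)\<^sup>2"
    using gamma_pos by (simp add: power2_eq_square)
  finally have 2: "df (X (Suc n) \<omega>) \<bullet> ?v \<le> df ?x \<bullet> ?v + C\<^sub>L * \<gamma> * (norm ?v)\<^sup>2"
    by (simp add: inner_diff_left)
  show ?thesis using 1 2 unfolding lyapunov_def by (simp add: algebra_simps)
qed

text \<open>Expanding backwards from \<open>X (Suc n)\<close> produces the same mixed term as in the
  Lyapunov function; the quadratic error is absorbed by its velocity term thanks to
  \<open>\<gamma> * C\<^sub>L \<le> b\<close>.\<close>

lemma objective_step_le:
  assumes "\<omega> \<in> space M"
  shows "(1 + a * \<gamma>) * f (X (Suc n) \<omega>)
    \<le> f (X n \<omega>) + \<gamma> * lyapunov (X (Suc n) \<omega>) (V (Suc n) \<omega>)"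
proof -
  let ?x = "X (Suc n) \<omega>" and ?v = "V (Suc n) \<omega>"
  have X: "X n \<omega> = ?x + - \<gamma> *\<^sub>R ?v" using X_step[OF assms] by simp
  have "f ?x - \<gamma> * (df ?x \<bullet> ?v) - C\<^sub>L / 2 * (\<gamma>\<^sup>2 * (norm ?v)\<^sup>2) \<le> f (X n \<omega>)"
    using lipschitz_gradient_lower_bound[OF gradient gradient_lipschitz, of ?x "- \<gamma> *\<^sub>R ?v"]
    by (simp add: X power_mult_distrib)
  moreover have "\<gamma> * (norm ?v)\<^sup>2 / 2 * (\<gamma> * C\<^sub>L) \<le> \<gamma> * (norm ?v)\<^sup>2 / 2 * b"
    using gamma_pos gamma_le by (intro mult_left_mono) auto
  ultimately show ?thesis
    unfolding lyapunov_def by (simp add: algebra_simps power2_eq_square)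
qed

section \<open>Contraction of the Lyapunov function in mean\<close>

lemma integrable_lyapunov: "integrable M (\<lambda>\<omega>. lyapunov (X n \<omega>) (V n \<omega>))"
  unfolding lyapunov_def
  by (intro Bochner_Integration.integrable_add integrable_mult_right integrable_f_X
      integrable_inner_df_V integrable_norm_V)

lemma integral_noise_le:
  "(\<integral>\<omega>. indicator (A n) \<omega> * (norm (D (Suc n) \<omega>))\<^sup>2 \<partial>M)
    \<le> \<sigma> * (\<integral>\<omega>. indicator (A n) \<omega> * f (X n \<omega>) \<partial>M)"
proof -
  have "(\<integral>\<omega>. indicator (A n) \<omega> * (norm (D (Suc n) \<omega>))\<^sup>2 \<partial>M)
    \<le> (\<integral>\<omega>. indicator (A n) \<omega> * (\<sigma> * f (X n \<omega>)) \<partial>M)"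
    by (rule integral_indicator_le_of_cond_exp_le[OF A_sets_F integrable_norm_D _ noise])
       (intro integrable_mult_right integrable_f_X)
  then show ?thesis by (simp only: integral_indicator_cmult)
qed

lemma integral_lyapunov_step_le:
  "(\<integral>\<omega>. indicator (A n) \<omega> * lyapunov (X (Suc n) \<omega>) (V (Suc n) \<omega>) \<partial>M)
    \<le> \<delta> * (\<integral>\<omega>. indicator (A n) \<omega> * lyapunov (X n \<omega>) (V n \<omega>) \<partial>M)"
proof -
  define K where "K = b / 2 + C\<^sub>L * \<gamma> + a * C\<^sub>L * \<gamma>\<^sup>2 / 2"
  have K: "K \<ge> 0"
    unfolding K_def using a_nonneg b_nonneg C_nonneg gamma_pos by (intro add_nonneg_nonneg) auto
  let ?I = "\<lambda>g. \<integral>\<omega>. indicator (A n) \<omega> * g \<omega> \<partial>M"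
  let ?f = "\<lambda>\<omega>. f (X n \<omega>)" and ?p = "\<lambda>\<omega>. df (X n \<omega>) \<bullet> drift n \<omega>"
    and ?w = "\<lambda>\<omega>. (norm (drift n \<omega>))\<^sup>2"
  have int_drift: "integrable M ?p" "integrable M ?w"
    using integrable_inner_square_integrable[OF df_L2[OF X_L2] drift_L2] drift_L2[of n]
    by (auto simp: square_integrable_def)
  have "?I (\<lambda>\<omega>. lyapunov (X (Suc n) \<omega>) (V (Suc n) \<omega>))
    \<le> ?I (\<lambda>\<omega>. a * f (X n \<omega>) + (1 + a * \<gamma>) * (df (X n \<omega>) \<bullet> V (Suc n) \<omega>) + K * (norm (V (Suc n) \<omega>))\<^sup>2)"
    unfolding K_def
    by (intro integral_mono integrable_indicator_mult A_sets integrable_lyapunov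
        Bochner_Integration.integrable_add integrable_mult_right integrable_f_X
        integrable_inner_df_V integrable_norm_V mult_left_mono lyapunov_step_le) auto
  also have "\<dots> = a * ?I ?f + (1 + a * \<gamma>) * ?I (\<lambda>\<omega>. df (X n \<omega>) \<bullet> V (Suc n) \<omega>)
      + K * ?I (\<lambda>\<omega>. (norm (V (Suc n) \<omega>))\<^sup>2)"
    by (rule integral_indicator_lincomb[OF A_sets integrable_f_X integrable_inner_df_V integrable_norm_V])
  also have "\<dots> = a * ?I ?f + (1 + a * \<gamma>) * ?I ?p
      + K * (?I ?w + \<gamma>\<^sup>2 * ?I (\<lambda>\<omega>. (norm (D (Suc n) \<omega>))\<^sup>2))"
    by (simp only: integral_inner_V_Suc[OF A_sets_F] integral_norm_V_Suc[OF A_sets_F])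
  also have "\<dots> \<le> a * ?I ?f + (1 + a * \<gamma>) * ?I ?p + K * (?I ?w + \<gamma>\<^sup>2 * (\<sigma> * ?I ?f))"
    by (intro add_left_mono mult_left_mono integral_noise_le K) auto
  also have "\<dots> = (a + K * \<gamma>\<^sup>2 * \<sigma>) * ?I ?f + (1 + a * \<gamma>) * ?I ?p + K * ?I ?w"
    by (simp add: algebra_simps)
  \<comment> \<open>The noise is gone, and everything is put back under one integral so that the
    coefficient bound can be applied pointwise on \<open>A n\<close>, where the gradient inequality
    is available.\<close>
  also have "\<dots> = ?I (\<lambda>\<omega>. (a + K * \<gamma>\<^sup>2 * \<sigma>) * ?f \<omega> + (1 + a * \<gamma>) * ?p \<omega> + K * ?w \<omega>)"
    by (rule integral_indicator_lincomb[OF A_sets integrable_f_X int_drift, symmetric])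
  also have "\<dots> \<le> ?I (\<lambda>\<omega>. \<delta> * lyapunov (X n \<omega>) (V n \<omega>))"
  proof (intro integral_mono integrable_indicator_mult A_sets integrable_lyapunov
        Bochner_Integration.integrable_add integrable_mult_right integrable_f_X int_drift)
    fix \<omega>
    have "(a + K * \<gamma>\<^sup>2 * \<sigma>) * ?f \<omega> + (1 + a * \<gamma>) * ?p \<omega> + K * ?w \<omega> \<le> \<delta> * lyapunov (X n \<omega>) (V n \<omega>)"
      if "\<omega> \<in> A n"
    proof -
      have "2 * L * ?f \<omega> \<le> (norm (df (X n \<omega>)))\<^sup>2"
        using that by (intro PL) (auto simp: stay_event_def)
      from lyapunov_coefficient_bound[OF cond gamma_pos f_nonneg zero_le_power2[of "norm (V n \<omega>)"] this,
          where p = "df (X n \<omega>) \<bullet> V n \<omega>"]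
      show ?thesis
        unfolding lyapunov_def norm_drift inner_drift K_def[symmetric] by (simp add: distrib_right mult.assoc)
    qed
    then show "indicator (A n) \<omega> * ((a + K * \<gamma>\<^sup>2 * \<sigma>) * ?f \<omega> + (1 + a * \<gamma>) * ?p \<omega> + K * ?w \<omega>)
      \<le> indicator (A n) \<omega> * (\<delta> * lyapunov (X n \<omega>) (V n \<omega>))"
      by (auto split: split_indicator)
  qed
  finally show ?thesis by (simp only: integral_indicator_cmult)
qed

section \<open>Recursions and rates for the means\<close>

definition rate :: real where "rate = max (1 / (1 + a * \<gamma>)) \<delta>"

text \<open>The event lags one step behind because a step from time \<open>n - 1\<close> is
  controlled on \<open>A (n - 1)\<close>. At \<open>n = 0\<close> truncated subtraction yields
  \<open>A 0\<close>.\<close>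

definition mean_objective :: "nat \<Rightarrow> real" where
  "mean_objective n = (\<integral>\<omega>. indicator (A (n - 1)) \<omega> * f (X n \<omega>) \<partial>M)"

definition mean_lyapunov :: "nat \<Rightarrow> real" where
  "mean_lyapunov n = (\<integral>\<omega>. indicator (A (n - 1)) \<omega> * lyapunov (X n \<omega>) (V n \<omega>) \<partial>M)"

lemma rate_pos: "rate > 0"
  unfolding rate_def using a_nonneg gamma_pos by (simp add: less_max_iff_disj add_pos_nonneg)

text \<open>The maximum in \<open>rate\<close> absorbs the convention for
  \<open>\<delta> = 0\<close>, since its first entry is positive.\<close>

lemma r_MSGD_eq: "r_MSGD C\<^sub>L \<mu> \<gamma> a b = 1 / rate"
proof -
  have "1 + a * \<gamma> > 0" using a_nonneg gamma_pos by (simp add: add_pos_nonneg)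
  then show ?thesis
    using delta_nonneg unfolding r_MSGD_def rate_def Let_def
    by (auto simp: min_def max_def field_simps)
qed

lemma mean_objective_nonneg: "mean_objective n \<ge> 0"
  unfolding mean_objective_def by (intro Bochner_Integration.integral_nonneg) (simp add: f_nonneg)

lemma mean_lyapunov_nonneg: "mean_lyapunov n \<ge> 0"
  unfolding mean_lyapunov_def by (intro Bochner_Integration.integral_nonneg) (simp add: lyapunov_nonneg)

text \<open>The stay events decrease, so enlarging the event closes the recursions for nonnegative
  integrands.\<close>

lemma integral_indicator_A_mono:
  fixes g :: "'w \<Rightarrow> real"
  assumes "integrable M g" "\<And>\<omega>. g \<omega> \<ge> 0"
  shows "(\<integral>\<omega>. indicator (A n) \<omega> * g \<omega> \<partial>M) \<le> (\<integral>\<omega>. indicator (A (n - 1)) \<omega> * g \<omega> \<partial>M)"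
  using assms A_antimono[of "n - 1" n]
  by (intro integral_mono integrable_indicator_mult A_sets mult_right_mono)
     (auto split: split_indicator)

lemma mean_lyapunov_Suc_le: "mean_lyapunov (Suc n) \<le> \<delta> * mean_lyapunov n"
proof -
  have "mean_lyapunov (Suc n) \<le> \<delta> * (\<integral>\<omega>. indicator (A n) \<omega> * lyapunov (X n \<omega>) (V n \<omega>) \<partial>M)"
    using integral_lyapunov_step_le by (simp add: mean_lyapunov_def)
  also have "\<dots> \<le> \<delta> * mean_lyapunov n"
    unfolding mean_lyapunov_def
    by (intro mult_left_mono integral_indicator_A_mono integrable_lyapunov lyapunov_nonneg delta_nonneg)
  finally show ?thesis .
qed

lemma mean_objective_Suc_le:
  "mean_objective (Suc n) \<le> 1 / (1 + a * \<gamma>) * (mean_objective n + \<gamma> * mean_lyapunov (Suc n))"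
proof -
  have pos: "1 + a * \<gamma> > 0" using a_nonneg gamma_pos by (simp add: add_pos_nonneg)
  let ?I = "\<lambda>g. \<integral>\<omega>. indicator (A n) \<omega> * g \<omega> \<partial>M"
  have "(1 + a * \<gamma>) * mean_objective (Suc n) = ?I (\<lambda>\<omega>. (1 + a * \<gamma>) * f (X (Suc n) \<omega>))"
    by (simp add: mean_objective_def integral_indicator_cmult)
  also have "\<dots> \<le> ?I (\<lambda>\<omega>. 1 * f (X n \<omega>) + \<gamma> * lyapunov (X (Suc n) \<omega>) (V (Suc n) \<omega>) + 0 * f (X n \<omega>))"
    by (intro integral_mono integrable_indicator_mult A_sets integrable_lyapunov
        Bochner_Integration.integrable_add integrable_mult_right integrable_f_X mult_left_mono)
       (auto simp: objective_step_le)
  also have "\<dots> = 1 * ?I (\<lambda>\<omega>. f (X n \<omega>)) + \<gamma> * ?I (\<lambda>\<omega>. lyapunov (X (Suc n) \<omega>) (V (Suc n) \<omega>))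
      + 0 * ?I (\<lambda>\<omega>. f (X n \<omega>))"
    by (rule integral_indicator_lincomb[OF A_sets integrable_f_X integrable_lyapunov integrable_f_X])
  also have "\<dots> \<le> mean_objective n + \<gamma> * mean_lyapunov (Suc n)"
    using integral_indicator_A_mono[OF integrable_f_X f_nonneg]
    by (simp add: mean_objective_def mean_lyapunov_def)
  finally show ?thesis using pos by (simp add: field_simps)
qed

lemma mean_bounds:
  obtains e \<phi> \<kappa> where "\<And>n. mean_lyapunov n \<le> e * rate ^ n"
    and "\<And>n. mean_objective n \<le> (\<phi> + \<kappa> * real n) * rate ^ n"
proof -
  have "1 / (1 + a * \<gamma>) > 0" using a_nonneg gamma_pos by (simp add: add_pos_nonneg)
  note bounds = coupled_recursion_bound[where e = mean_lyapunov and \<phi> = mean_objective,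
      OF this delta_nonneg less_imp_le[OF gamma_pos] mean_lyapunov_nonneg mean_objective_nonneg
        mean_lyapunov_Suc_le mean_objective_Suc_le, folded rate_def]
  show thesis by (rule that[OF bounds])
qed

section \<open>Convergence of the objective and of the process\<close>

text \<open>The loss \<open>\<epsilon>\<close> pays for the linear factor: after multiplication by
  \<open>s ^ n\<close> the bound is affine times a power of \<open>s * rate < 1\<close>.\<close>

lemma mean_objective_smallo:
  assumes "0 < \<epsilon>" "\<epsilon> < r_MSGD C\<^sub>L \<mu> \<gamma> a b"
  shows "mean_objective \<in> o(\<lambda>n. (r_MSGD C\<^sub>L \<mu> \<gamma> a b - \<epsilon>) powi (- int n))"
proof -
  define s where "s = r_MSGD C\<^sub>L \<mu> \<gamma> a b - \<epsilon>"
  have s: "0 < s" "s * rate < 1"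
    using assms rate_pos by (auto simp: s_def r_MSGD_eq field_simps)
  obtain \<phi> \<kappa> where bound: "\<And>n. mean_objective n \<le> (\<phi> + \<kappa> * real n) * rate ^ n"
    using mean_bounds by metis
  have upper: "mean_objective n * s ^ n \<le> (\<phi> + \<kappa> * real n) * (s * rate) ^ n" for n
    using mult_right_mono[OF bound[of n], of "s ^ n"] s by (simp add: power_mult_distrib mult_ac)
  have lower: "mean_objective n * s ^ n \<ge> 0" for n
    using mean_objective_nonneg s by simp
  have "(\<lambda>n. (\<phi> + \<kappa> * real n) * (s * rate) ^ n) \<longlonglongrightarrow> 0"
    using s rate_pos by (intro summable_LIMSEQ_zero summable_affine_geometric) auto
  then have "(\<lambda>n. mean_objective n * s ^ n) \<longlonglongrightarrow> 0"
    by (rule tendsto_sandwich[OF always_eventually[OF allI[OF lower]]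
        always_eventually[OF allI[OF upper]] tendsto_const])
  then have "mean_objective \<in> o(\<lambda>n. s powi (- int n))"
    using s by (intro smalloI_tendsto) (auto simp: power_int_minus divide_inverse)
  then show ?thesis by (simp add: s_def)
qed

text \<open>For \<open>C\<^sub>L = 0\<close> the constants may vanish: \<open>a = 0\<close> gives
  \<open>rate = 1\<close>, and \<open>b = 0\<close> removes the velocity from the Lyapunov function.
  That case is therefore treated directly.\<close>

lemma mean_square_velocity_bound:
  assumes delta: "\<delta> < 1"
  obtains c d \<rho> where "0 \<le> \<rho>" "\<rho> < 1"
    and "\<And>n. (\<integral>\<omega>. indicator (A (n - 1)) \<omega> * (norm (V n \<omega>))\<^sup>2 \<partial>M) \<le> (c + d * real n) * \<rho> ^ n"
proof (cases "C\<^sub>L = 0")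
  case True
  \<comment> \<open>Here \<open>f\<close> vanishes, hence so does the noise on the stay events, and only the friction acts.\<close>
  let ?v = "\<lambda>n. \<integral>\<omega>. indicator (A (n - 1)) \<omega> * (norm (V n \<omega>))\<^sup>2 \<partial>M"
  let ?\<rho> = "(1 - \<gamma> * \<mu>)\<^sup>2"
  have \<rho>: "0 \<le> ?\<rho>" "?\<rho> < 1"
    using friction_factor_less_1[OF cond gamma_pos friction_pos C_nonneg delta] by auto
  have df0: "df x = 0" for x using gradient_norm_le[of x] True by simp
  \<comment> \<open>The descent bound with zero gradient and zero constant compares any two values,
    so \<open>f\<close> is constant and equal to its infimum.\<close>
  have "f x \<le> f y" for x y
    using lipschitz_gradient_upper_bound[OF gradient gradient_lipschitz, of y "x - y"] df0 True by simp
  then have "f x \<le> (INF y. f y)" for x by (intro cINF_greatest) auto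
  then have f0: "f x = 0" for x using f_inf f_nonneg[of x] by (simp add: antisym)
  have step: "?v (Suc n) \<le> ?\<rho> * ?v n" for n
  proof -
    have "?v (Suc n) \<le> (\<integral>\<omega>. indicator (A n) \<omega> * (norm (drift n \<omega>))\<^sup>2 \<partial>M)"
      using integral_norm_V_Suc[OF A_sets_F, of n] integral_noise_le[of n] gamma_pos
      by (simp add: f0 mult_nonneg_nonpos)
    also have "\<dots> = ?\<rho> * (\<integral>\<omega>. indicator (A n) \<omega> * (norm (V n \<omega>))\<^sup>2 \<partial>M)"
      by (simp add: norm_drift df0 integral_indicator_cmult)
    also have "\<dots> \<le> ?\<rho> * ?v n"
      by (intro mult_left_mono integral_indicator_A_mono integrable_norm_V) auto
    finally show ?thesis .
  qed
  have "?v n \<le> (?v 0 + 0 * real n) * ?\<rho> ^ n" for n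
  proof (induction n)
    case (Suc n)
    have "?v (Suc n) \<le> ?\<rho> * ?v n" by (rule step)
    also have "\<dots> \<le> ?\<rho> * ((?v 0 + 0 * real n) * ?\<rho> ^ n)" using Suc by (rule mult_left_mono) simp
    finally show ?case by (simp add: mult_ac)
  qed simp
  then show thesis using \<rho> that by blast
next
  case False
  \<comment> \<open>Now \<open>a > 0\<close> gives \<open>rate < 1\<close>, and \<open>b > 0\<close>
    lets the Lyapunov function and \<open>f\<close> bound the velocity.\<close>
  then have "a * b > 0" using ab_ge C_nonneg by linarith
  then have a: "a > 0" and b: "b > 0"
    using a_nonneg b_nonneg by (auto simp: zero_less_mult_iff)
  have "1 / (1 + a * \<gamma>) < 1" using mult_pos_pos[OF a gamma_pos] by (simp add: field_simps)
  then have rate: "rate < 1" using delta by (simp add: rate_def)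
  obtain e \<phi> \<kappa> where e: "\<And>n. mean_lyapunov n \<le> e * rate ^ n"
    and \<phi>: "\<And>n. mean_objective n \<le> (\<phi> + \<kappa> * real n) * rate ^ n"
    using mean_bounds by metis
  let ?c = "4 / b * (e + 2 * C\<^sub>L / b * \<phi>)" and ?d = "4 / b * (2 * C\<^sub>L / b * \<kappa>)"
  have "(\<integral>\<omega>. indicator (A (n - 1)) \<omega> * (norm (V n \<omega>))\<^sup>2 \<partial>M) \<le> (?c + ?d * real n) * rate ^ n" for n
  proof -
    let ?I = "\<lambda>g. \<integral>\<omega>. indicator (A (n - 1)) \<omega> * g \<omega> \<partial>M"
    have "?I (\<lambda>\<omega>. (norm (V n \<omega>))\<^sup>2)
      \<le> ?I (\<lambda>\<omega>. 4 / b * lyapunov (X n \<omega>) (V n \<omega>) + 4 / b * (2 * C\<^sub>L / b) * f (X n \<omega>) + 0 * f (X n \<omega>))"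
    proof (intro integral_mono integrable_indicator_mult A_sets integrable_lyapunov integrable_norm_V
        Bochner_Integration.integrable_add integrable_mult_right integrable_f_X mult_left_mono)
      show "(norm (V n \<omega>))\<^sup>2
        \<le> 4 / b * lyapunov (X n \<omega>) (V n \<omega>) + 4 / b * (2 * C\<^sub>L / b) * f (X n \<omega>) + 0 * f (X n \<omega>)" for \<omega>
        using norm_velocity_le_lyapunov[OF b, of "V n \<omega>" "X n \<omega>"] by (simp add: distrib_left)
    qed simp
    also have "\<dots> = 4 / b * mean_lyapunov n + 4 / b * (2 * C\<^sub>L / b) * mean_objective n + 0 * mean_objective n"
      unfolding mean_lyapunov_def mean_objective_def
      by (rule integral_indicator_lincomb[OF A_sets integrable_lyapunov integrable_f_X integrable_f_X])
    also have "\<dots> \<le> 4 / b * (e * rate ^ n) + 4 / b * (2 * C\<^sub>L / b) * ((\<phi> + \<kappa> * real n) * rate ^ n) + 0"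
      using b C_nonneg by (intro add_mono mult_left_mono e \<phi>) auto
    also have "\<dots> = (?c + ?d * real n) * rate ^ n"
      by (simp add: algebra_simps)
    finally show ?thesis .
  qed
  then show thesis using rate rate_pos that[of rate ?c ?d] by simp
qed

lemma AE_convergent:
  assumes delta: "\<delta> < 1"
  shows "AE \<omega> in M. \<omega> \<in> (\<Inter>n. A n) \<longrightarrow> convergent (\<lambda>n. X n \<omega>)"
proof -
  obtain c d \<rho> where \<rho>: "0 \<le> \<rho>" "\<rho> < 1"
    and v: "\<And>n. (\<integral>\<omega>. indicator (A (n - 1)) \<omega> * (norm (V n \<omega>))\<^sup>2 \<partial>M) \<le> (c + d * real n) * \<rho> ^ n"
    using mean_square_velocity_bound[OF delta] by metis
  \<comment> \<open>The weights \<open>s ^ n\<close> trade the mean square bound for the pointwise bound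
    \<open>norm v \<le> s ^ n + (norm v)\<^sup>2 / s ^ n\<close>, whose terms are summable.\<close>
  define s where "s = (1 + \<rho>) / 2"
  \<comment> \<open>The midpoint of \<open>\<rho>\<close> and 1 is positive even for
    \<open>\<rho> = 0\<close>, and both \<open>s\<close> and \<open>\<rho> / s\<close> are
    admissible geometric ratios.\<close>
  have s: "0 < s" "s < 1" "\<rho> / s < 1" using \<rho> by (auto simp: s_def)
  define g where "g n \<omega> = indicator (A (n - 1)) \<omega> * (norm (V n \<omega>))\<^sup>2 / s ^ n" for n \<omega>
  have "AE \<omega> in M. summable (\<lambda>n. g n \<omega>)"
  proof (rule AE_summable_of_summable_integral)
    show "integrable M (g n)" for n
      unfolding g_def
      by (intro integrable_divide_zero integrable_indicator_mult A_sets integrable_norm_V)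
    show "g n \<omega> \<ge> 0" for n \<omega> using s by (simp add: g_def)
    show "summable (\<lambda>n. \<integral>\<omega>. g n \<omega> \<partial>M)"
    proof (rule summable_comparison_test')
      show "summable (\<lambda>n. (c + d * real n) * (\<rho> / s) ^ n)"
        using \<rho> s by (intro summable_affine_geometric) auto
      fix n
      have "(\<integral>\<omega>. g n \<omega> \<partial>M) \<ge> 0"
        using s by (intro Bochner_Integration.integral_nonneg) (simp add: g_def)
      moreover have "(\<integral>\<omega>. g n \<omega> \<partial>M) \<le> (c + d * real n) * (\<rho> / s) ^ n"
        using divide_right_mono[OF v[of n], of "s ^ n"] s by (simp add: g_def power_divide)
      ultimately show "norm (\<integral>\<omega>. g n \<omega> \<partial>M) \<le> (c + d * real n) * (\<rho> / s) ^ n" by simp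
    qed
  qed
  then show ?thesis
    using AE_space
  proof eventually_elim
    case (elim \<omega>)
    show ?case
    proof
      assume \<omega>: "\<omega> \<in> (\<Inter>n. A n)"
      have V_le: "norm (V n \<omega>) \<le> s ^ n + g n \<omega>" for n
      proof -
        have "2 * (s ^ n * norm (V n \<omega>)) \<le> (s ^ n)\<^sup>2 + (norm (V n \<omega>))\<^sup>2"
          using sum_squares_bound[of "s ^ n" "norm (V n \<omega>)"] by (simp add: mult.assoc)
        moreover have "s ^ n * norm (V n \<omega>) \<ge> 0" using s by simp
        ultimately have "s ^ n * norm (V n \<omega>) \<le> (s ^ n)\<^sup>2 + (norm (V n \<omega>))\<^sup>2"
          by linarith
        \<comment> \<open>On the intersection of all stay events every indicator in \<open>g\<close>
          equals 1.\<close>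
        also have "\<dots> = s ^ n * (s ^ n + g n \<omega>)"
          using \<omega> s by (simp add: g_def field_simps power2_eq_square)
        finally show ?thesis using s by simp
      qed
      have "summable (\<lambda>n. s ^ n + g n \<omega>)"
        using s elim by (intro summable_add summable_geometric) auto
      then have "summable (\<lambda>n. norm (V n \<omega>))"
        by (rule summable_comparison_test') (use V_le in auto)
      then have "summable (\<lambda>n. V (Suc n) \<omega>)"
        by (intro summable_Suc_iff[where f = "\<lambda>n. V n \<omega>", THEN iffD2]
            summable_norm_cancel[where f = "\<lambda>n. V n \<omega>"])
      then have "summable (\<lambda>n. X (Suc n) \<omega> - X n \<omega>)"
        using elim by (simp add: X_step summable_scaleR_right)
      then have "convergent (\<lambda>n. X n \<omega> - X 0 \<omega>)"
        by (simp only: summable_iff_convergent sum_lessThan_telescope[of "\<lambda>n. X n \<omega>"])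
      then have "convergent (\<lambda>n. X n \<omega> - X 0 \<omega> + X 0 \<omega>)"
        by (intro convergent_add convergent_const)
      then show "convergent (\<lambda>n. X n \<omega>)" by simp
    qed
  qed
qed

end

section \<open>Decay, almost sure convergence and admissible step sizes combined\<close>

theorem theorem1p1:
  fixes M :: "'w measure" and F :: "nat \<Rightarrow> 'w measure"
    and f :: "'a::euclidean_space \<Rightarrow> real" and df :: "'a \<Rightarrow> 'a"
    and X V D :: "nat \<Rightarrow> 'w \<Rightarrow> 'a" and U :: "'a set"
    and C\<^sub>L L \<sigma> \<mu> \<gamma> a b :: real
  assumes "C\<^sub>L \<ge> 0" and "L > 0" and "\<sigma> \<ge> 0" and "\<mu> > 0"
  shows
    "(\<gamma> > 0 \<and>
      msgd M F f df C\<^sub>L \<mu> (\<lambda>_. \<gamma>) X V D \<and>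
      open U \<and>
      (\<forall>x\<in>U. (norm (df x))\<^sup>2 \<ge> 2 * L * f x) \<and>
      (\<forall>n. AE \<omega> in M. \<omega> \<in> stay_event M X U n \<longrightarrow>
         real_cond_exp M (F n) (\<lambda>\<omega>. (norm (D (Suc n) \<omega>))\<^sup>2) \<omega> \<le> \<sigma> * f (X n \<omega>)) \<and>
      msgd_conditions C\<^sub>L L \<sigma> \<mu> \<gamma> a b
      \<longrightarrow>
      (\<forall>\<epsilon>. 0 < \<epsilon> \<and> \<epsilon> < r_MSGD C\<^sub>L \<mu> \<gamma> a b \<longrightarrow>
         (\<lambda>n. integral\<^sup>L M (\<lambda>\<omega>. indicator (stay_event M X U (n - 1)) \<omega> * f (X n \<omega>)))
           \<in> o(\<lambda>n. (r_MSGD C\<^sub>L \<mu> \<gamma> a b - \<epsilon>) powi (- int n))) \<and>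
      (msgd_delta C\<^sub>L \<mu> \<gamma> a b < 1 \<longrightarrow>
         (AE \<omega> in M. \<omega> \<in> (\<Inter>n. stay_event M X U n) \<longrightarrow> convergent (\<lambda>n. X n \<omega>))))
     \<and>
     (\<exists>\<gamma>\<^sub>0>0. \<forall>\<gamma>. 0 < \<gamma> \<and> \<gamma> \<le> \<gamma>\<^sub>0 \<longrightarrow>
        (\<exists>a b. msgd_conditions C\<^sub>L L \<sigma> \<mu> \<gamma> a b \<and> msgd_delta C\<^sub>L \<mu> \<gamma> a b < 1))"
proof (intro conjI impI)
  assume "\<gamma> > 0 \<and>
      msgd M F f df C\<^sub>L \<mu> (\<lambda>_. \<gamma>) X V D \<and>
      open U \<and>
      (\<forall>x\<in>U. (norm (df x))\<^sup>2 \<ge> 2 * L * f x) \<and>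
      (\<forall>n. AE \<omega> in M. \<omega> \<in> stay_event M X U n \<longrightarrow>
         real_cond_exp M (F n) (\<lambda>\<omega>. (norm (D (Suc n) \<omega>))\<^sup>2) \<omega> \<le> \<sigma> * f (X n \<omega>)) \<and>
      msgd_conditions C\<^sub>L L \<sigma> \<mu> \<gamma> a b"
  then interpret msgd_pl_domain M F f df C\<^sub>L \<mu> \<gamma> X V D U L \<sigma> a b
    by (intro msgd_pl_domain.intro msgd_pl_domain_axioms.intro) auto
  show "\<forall>\<epsilon>. 0 < \<epsilon> \<and> \<epsilon> < r_MSGD C\<^sub>L \<mu> \<gamma> a b \<longrightarrow>
         (\<lambda>n. integral\<^sup>L M (\<lambda>\<omega>. indicator (stay_event M X U (n - 1)) \<omega> * f (X n \<omega>)))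
           \<in> o(\<lambda>n. (r_MSGD C\<^sub>L \<mu> \<gamma> a b - \<epsilon>) powi (- int n))"
    using mean_objective_smallo unfolding mean_objective_def by blast
  show "AE \<omega> in M. \<omega> \<in> (\<Inter>n. stay_event M X U n) \<longrightarrow> convergent (\<lambda>n. X n \<omega>)"
    if "msgd_delta C\<^sub>L \<mu> \<gamma> a b < 1"
    using that by (rule AE_convergent)
next
  obtain a b where
    "\<forall>\<^sub>F \<gamma> in at_right 0. msgd_conditions C\<^sub>L L \<sigma> \<mu> \<gamma> a b \<and> msgd_delta C\<^sub>L \<mu> \<gamma> a b < 1"
    using msgd_conditions_small_step[OF assms(1,2,4)] by blast
  then obtain \<gamma>\<^sub>1 where "\<gamma>\<^sub>1 > 0"
    "\<And>\<gamma>. 0 < \<gamma> \<Longrightarrow> \<gamma> < \<gamma>\<^sub>1 \<Longrightarrow> msgd_conditions C\<^sub>L L \<sigma> \<mu> \<gamma> a b \<and> msgd_delta C\<^sub>L \<mu> \<gamma> a b < 1"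
    unfolding eventually_at_right_field by auto
  then show "\<exists>\<gamma>\<^sub>0>0. \<forall>\<gamma>. 0 < \<gamma> \<and> \<gamma> \<le> \<gamma>\<^sub>0 \<longrightarrow>
        (\<exists>a b. msgd_conditions C\<^sub>L L \<sigma> \<mu> \<gamma> a b \<and> msgd_delta C\<^sub>L \<mu> \<gamma> a b < 1)"
    \<comment> \<open>Halving turns the strict bound \<open>\<gamma> < \<gamma>\<^sub>1\<close> into
      the required closed one.\<close>
    by (intro exI[of _ "\<gamma>\<^sub>1 / 2"] conjI allI impI exI[of _ a, OF exI[of _ b]]) auto
qed

end
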